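(* Let $\mathbb{K}$ be a field of characteristic zero, $W$ a finite-dimensional $\mathbb{K}$-vector space, and $T(W)$ its tensor algebra. The cohomology class of $\mathrm{Tr}(c_{\nabla_W}^{\;k})$ does not vanish in $H^k_{\mathrm{CE}}(\mathrm{Der}_{\mathbb K}(T(W)),|T(W)^{\mathrm e}|)$ for odd $k$.
   Context: For a unital associative $\mathbb{K}$-algebra $B$: $|B|=B/[B,B]$ is the quotient by the $\mathbb{K}$-span of commutators; $B^{\mathrm e}=B\otimes B^{\mathrm{op}}$; $\Omega^1B$ is the $B$-bimodule generated by symbols $db$ ($b\in B$) subject to $d$ being $\mathbb{K}$-linear and $d(bb')=(db)b'+b(db')$. For $f\in\mathrm{Der}_{\mathbb K}(B)$, $i_f\colon\Omega^1B\to B$ is the bimodule map with $i_f(db)=f(b)$ and $L_f\colon\Omega^1B\to\Omega^1B$ is $L_f(b\,db')=f(b)db'+b\,d(f(b'))$. Let $A=T(W)$, and regard $\Omega^1A$ as a (free, finite rank) left module over $A^{\mathrm e}$. For $f\in\mathrm{Der}_{\mathbb K}(A)$ put $\varphi(f)=f\otimes\mathrm{id}+\mathrm{id}\otimes f\in\mathrm{Der}_{\mathbb K}(A^{\mathrm e})$. The canonical flat connection $\nabla_W\colon\Omega^1A\to\Omega^1(A^{\mathrm e})\otimes_{A^{\mathrm e}}\Omega^1A$ is the $\mathbb{K}$-linear map satisfying $\nabla_W(bm)=db\otimes m+b\nabla_W(m)$ for $b\in A^{\mathrm e}$, $m\in\Omega^1A$, and $\nabla_W(dw)=0$ for all $w\in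 W$. Define $c_{\nabla_W}\colon\mathrm{Der}_{\mathbb K}(A)\to\mathrm{End}_{A^{\mathrm e}}(\Omega^1A)$ by $c_{\nabla_W}(f)=(i_{\varphi(f)}\otimes\mathrm{id})\circ\nabla_W-L_f$. The trace $\mathrm{Tr}\colon\mathrm{End}_{A^{\mathrm e}}(\Omega^1A)\cong(\Omega^1A)^*\otimes_{A^{\mathrm e}}\Omega^1A\to|A^{\mathrm e}|$, where $(\Omega^1A)^*=\mathrm{Hom}_{A^{\mathrm e}}(\Omega^1A,A^{\mathrm e})$, is $\mu\otimes m\mapsto|\mu(m)|$. For an integer $k\ge 1$, the element $\mathrm{Tr}(c_{\nabla_W}^{\;k})\in\mathrm{Hom}_{\mathbb K}(\wedge^k\mathrm{Der}_{\mathbb K}(A),|A^{\mathrm e}|)$ is $$f_1\wedge\cdots\wedge f_k\mapsto\sum_{s\in S_k}\mathrm{sgn}(s)\,\mathrm{Tr}\big(c_{\nabla_W}(f_{s(1)})\circ\cdots\circ c_{\nabla_W}(f_{s(k)})\big),$$ which is a Chevalley–Eilenberg cocycle. $H^\bullet_{\mathrm{CE}}$ denotes Chevalley–Eilenberg (Lie algebra) cohomology, where $f\in\mathrm{Der}_{\mathbb K}(A)$ acts on $|A^{\mathrm e}|$ by $f\cdot|b|=|\varphi(f)(b)|$.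
   Formalization: The formal statement assumes dim W ≥ 2, or dim W = 1 and k = 1; the excluded cases are false: for dim W = 0 there are no nonzero derivations, and for dim W = 1 with odd k ≥ 3 the endomorphisms commute, so the cochain is zero. *)

theory Defs
  imports
    "HOL-Library.Poly_Mapping"
    "HOL-Library.Product_Plus"
    "HOL-Library.Function_Algebras"
    "HOL-Combinatorics.Permutations"
    "HOL-Analysis.Finite_Cartesian_Product"
begin

section \<open>Free vector spaces and monoid algebras\<close>

text \<open>
  \<open>'x \<Rightarrow>\<^sub>0 'k\<close> is the free \<open>'k\<close>-vector space on \<open>'x\<close>. When \<open>'m\<close> is a monoid (written additively,
  but not assumed commutative) it carries the convolution product of the library, so that
  \<open>'m \<Rightarrow>\<^sub>0 'k\<close> is the monoid algebra of \<open>'m\<close>.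
\<close>

definition scal :: "'k::field \<Rightarrow> ('x \<Rightarrow>\<^sub>0 'k) \<Rightarrow> ('x \<Rightarrow>\<^sub>0 'k)" where
  "scal r p = Poly_Mapping.map ((*) r) p"

lemma lookup_scal [simp]: "Poly_Mapping.lookup (scal r p) x = r * Poly_Mapping.lookup p x"
  by (simp add: scal_def map.rep_eq when_def)

global_interpretation free: vector_space "scal :: 'k::field \<Rightarrow> ('x \<Rightarrow>\<^sub>0 'k) \<Rightarrow> ('x \<Rightarrow>\<^sub>0 'k)"
  by unfold_locales (auto intro!: poly_mapping_eqI simp: lookup_add algebra_simps)

abbreviation gen :: "'x \<Rightarrow> ('x \<Rightarrow>\<^sub>0 'k::field)" where
  "gen x \<equiv> Poly_Mapping.single x 1"

lemma scal_gen: "scal r (gen x) = Poly_Mapping.single x r"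
  by (rule poly_mapping_eqI) (simp add: lookup_single when_def)

definition fext :: "('x \<Rightarrow> ('y \<Rightarrow>\<^sub>0 'k)) \<Rightarrow> ('x \<Rightarrow>\<^sub>0 'k::field) \<Rightarrow> ('y \<Rightarrow>\<^sub>0 'k)" where
  "fext h p = (\<Sum>x\<in>Poly_Mapping.keys p. scal (Poly_Mapping.lookup p x) (h x))"

lemma fext_superset:
  assumes "finite S" "Poly_Mapping.keys p \<subseteq> S"
  shows "fext h p = (\<Sum>x\<in>S. scal (Poly_Mapping.lookup p x) (h x))"
  unfolding fext_def by (rule sum.mono_neutral_left) (use assms in \<open>auto simp: in_keys_iff\<close>)

lemma fext_gen [simp]: "fext h (gen x) = h x"
  by (simp add: fext_def)

lemma fext_linear: "Vector_Spaces.linear scal scal (fext h)"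
proof (unfold_locales, goal_cases)
  case (1 p q)
  have "Poly_Mapping.keys (p + q) \<subseteq> Poly_Mapping.keys p \<union> Poly_Mapping.keys q" by (rule Poly_Mapping.keys_add)
  then show ?case
    by (simp add: fext_superset[of "Poly_Mapping.keys p \<union> Poly_Mapping.keys q"] lookup_add free.scale_left_distrib sum.distrib)
next
  case (2 r p)
  have "Poly_Mapping.keys (scal r p) \<subseteq> Poly_Mapping.keys p" by (auto simp: in_keys_iff)
  then show ?case
    by (simp add: fext_superset[of "Poly_Mapping.keys p"] free.scale_sum_right)
qed

lemma fext_add [simp]: "fext h (p + q) = fext h p + fext h q"
  and fext_diff [simp]: "fext h (p - q) = fext h p - fext h q"
  and fext_scal [simp]: "fext h (scal r p) = scal r (fext h p)"
proof -
  interpret Vector_Spaces.linear scal scal "fext h" by (rule fext_linear)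
  show "fext h (p + q) = fext h p + fext h q" "fext h (p - q) = fext h p - fext h q"
    "fext h (scal r p) = scal r (fext h p)"
    by (rule add diff scale)+
qed

lemma fext_span:
  assumes "\<And>x. x \<in> R \<Longrightarrow> fext h x \<in> free.span R'" "p \<in> free.span R"
  shows "fext h p \<in> free.span R'"
  using assms(2)
proof (induction rule: free.span_induct_alt)
  case base
  then show ?case by (simp add: fext_def free.span_zero)
next
  case (step c x y)
  then show ?case using assms(1) by (auto intro!: free.span_add free.span_scale)
qed

definition modrel :: "('x \<Rightarrow>\<^sub>0 'k::field) set \<Rightarrow> ('x \<Rightarrow>\<^sub>0 'k) \<Rightarrow> ('x \<Rightarrow>\<^sub>0 'k) \<Rightarrow> bool" where
  "modrel R p q \<longleftrightarrow> p - q \<in> free.span R"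

lemma equivp_modrel: "equivp (modrel R)"
proof (rule equivpI)
  show "reflp (modrel R)" by (simp add: reflp_def modrel_def free.span_zero)
  show "symp (modrel R)"
  proof (rule sympI)
    fix p q assume "modrel R p q"
    then have "- (p - q) \<in> free.span R" unfolding modrel_def by (rule free.span_neg)
    then show "modrel R q p" by (simp add: modrel_def)
  qed
  show "transp (modrel R)"
  proof (rule transpI)
    fix p q s assume "modrel R p q" "modrel R q s"
    then have "(p - q) + (q - s) \<in> free.span R" unfolding modrel_def by (rule free.span_add)
    then show "modrel R p s" by (simp add: modrel_def)
  qed
qed

lemma modrel_add: "modrel R p q \<Longrightarrow> modrel R p' q' \<Longrightarrow> modrel R (p + p') (q + q')"
proof -
  assume "modrel R p q" "modrel R p' q'"
  then have "(p - q) + (p' - q') \<in> free.span R" unfolding modrel_def by (rule free.span_add)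
  then show ?thesis by (simp add: modrel_def add_diff_add)
qed

lemma modrel_diff: "modrel R p q \<Longrightarrow> modrel R p' q' \<Longrightarrow> modrel R (p - p') (q - q')"
proof -
  assume "modrel R p q" "modrel R p' q'"
  then have "(p - q) - (p' - q') \<in> free.span R"
    unfolding modrel_def by (rule free.span_diff)
  moreover have "(p - q) - (p' - q') = (p - p') - (q - q')" by (simp add: algebra_simps)
  ultimately show ?thesis by (simp add: modrel_def)
qed

lemma modrel_uminus: "modrel R p q \<Longrightarrow> modrel R (- p) (- q)"
  using modrel_diff[of R 0 0 p q] by (simp add: modrel_def free.span_zero)

lemma modrel_scal: "modrel R p q \<Longrightarrow> modrel R (scal r p) (scal r q)"
  by (simp add: modrel_def flip: free.scale_right_diff_distrib) (rule free.span_scale)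

lemma modrel_fext:
  assumes "\<And>x. x \<in> R \<Longrightarrow> fext h x \<in> free.span R'" "modrel R p q"
  shows "modrel R' (fext h p) (fext h q)"
  using fext_span[OF assms(1), where p = "p - q"] assms(2) by (simp add: modrel_def)

section \<open>Tensor algebra and enveloping algebra\<close>

datatype 'n fmon = Word (letters: "'n list")

instantiation fmon :: (type) monoid_add
begin
definition "0 = Word []"
definition "u + v = Word (letters u @ letters v)"
instance by standard (simp_all add: zero_fmon_def plus_fmon_def)
end

datatype 'm opp = Op (unop: 'm)

instantiation opp :: (monoid_add) monoid_add
begin
definition "0 = Op 0"
definition "u + v = Op (unop v + unop u)"
instance by standard (simp_all add: zero_opp_def plus_opp_def add.assoc)
end

text \<open>
  For \<open>W = 'k ^ 'n\<close> the tensor algebra \<open>T(W)\<close> is the free associative algebra on \<open>'n\<close>: the words of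
  length \<open>m\<close>, i.e. the \<open>m\<close>-fold tensors of standard basis vectors, are a basis of the \<open>m\<close>-th tensor
  power of \<open>W\<close>, and the product is concatenation.
\<close>

type_synonym ('n, 'k) talg = "'n fmon \<Rightarrow>\<^sub>0 'k"

definition incl :: "'k::field ^ 'n \<Rightarrow> ('n, 'k) talg" where
  "incl w = (\<Sum>i\<in>UNIV. Poly_Mapping.single (Word [i]) (w $ i))"

text \<open>
  For \<open>B\<close> the monoid algebra of \<open>'m\<close>, the tensor product of \<open>B\<close> with its opposite has the pairs of
  elements of \<open>'m\<close> as a basis, and it is the monoid algebra of \<open>'m \<times> 'm opp\<close>;
  \<open>tens a b\<close> is the pure tensor of \<open>a\<close> and \<open>b\<close> (see \<open>tens_mult\<close>).
\<close>

type_synonym ('m, 'k) env = "('m \<times> 'm opp) \<Rightarrow>\<^sub>0 'k"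

definition tens :: "('m \<Rightarrow>\<^sub>0 'k::field) \<Rightarrow> ('m \<Rightarrow>\<^sub>0 'k) \<Rightarrow> ('m, 'k) env" where
  "tens a b = (\<Sum>u\<in>Poly_Mapping.keys a. \<Sum>v\<in>Poly_Mapping.keys b. Poly_Mapping.single (u, Op v) (Poly_Mapping.lookup a u * Poly_Mapping.lookup b v))"

lemma lookup_tens: "Poly_Mapping.lookup (tens a b) (u, Op v) = Poly_Mapping.lookup a u * Poly_Mapping.lookup b v"
proof -
  have "Poly_Mapping.lookup (tens a b) (u, Op v)
    = (\<Sum>x\<in>Poly_Mapping.keys a. \<Sum>y\<in>Poly_Mapping.keys b. if x = u \<and> y = v then Poly_Mapping.lookup a u * Poly_Mapping.lookup b v else 0)"
    unfolding tens_def by (auto simp: lookup_sum lookup_single when_def intro!: sum.cong)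
  also have "\<dots> = (\<Sum>x\<in>Poly_Mapping.keys a. if x = u then (\<Sum>y\<in>Poly_Mapping.keys b. if y = v then Poly_Mapping.lookup a u * Poly_Mapping.lookup b v else 0) else 0)"
    by (intro sum.cong refl) (rename_tac x, case_tac "x = u"; simp)
  also have "\<dots> = Poly_Mapping.lookup a u * Poly_Mapping.lookup b v"
    by (subst sum.delta, simp, subst sum.delta, simp, simp add: in_keys_iff)
  finally show ?thesis .
qed

lemma lookup_tens': "Poly_Mapping.lookup (tens a b) x = Poly_Mapping.lookup a (fst x) * Poly_Mapping.lookup b (unop (snd x))"
  by (cases x; cases "snd x") (auto simp: lookup_tens)

lemma tens_add_left: "tens (a + a') b = tens a b + tens a' b"
  and tens_add_right: "tens a (b + b') = tens a b + tens a b'"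
  and tens_scal_left: "tens (scal r a) b = scal r (tens a b)"
  and tens_scal_right: "tens a (scal r b) = scal r (tens a b)"
  by (rule poly_mapping_eqI; simp add: lookup_tens' lookup_add algebra_simps)+

lemma tens_zero_left [simp]: "tens 0 b = 0"
  and tens_zero_right [simp]: "tens a 0 = 0"
  by (rule poly_mapping_eqI; simp add: lookup_tens')+

lemma tens_single:
  fixes u v :: 'a
  shows "tens (Poly_Mapping.single u r) (Poly_Mapping.single v s) = Poly_Mapping.single (u, Op v) (r * s)"
proof (rule poly_mapping_eqI)
  fix x :: "'a \<times> 'a opp"
  obtain u' v' where "x = (u', Op v')" by (metis opp.exhaust surj_pair)
  then show "Poly_Mapping.lookup (tens (Poly_Mapping.single u r) (Poly_Mapping.single v s)) x
      = Poly_Mapping.lookup (Poly_Mapping.single (u, Op v) (r * s)) x"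
    by (simp add: lookup_tens lookup_single when_def)
qed

lemma poly_mapping_induct_single [case_names zero add]:
  assumes "P 0" "\<And>p x r. P p \<Longrightarrow> P (p + Poly_Mapping.single x r)"
  shows "P (p :: 'x \<Rightarrow>\<^sub>0 'k::field)"
proof -
  have "P (\<Sum>x\<in>S. Poly_Mapping.single x (Poly_Mapping.lookup p x))" if "finite S" for S
    using that
  proof (induction S)
    case empty
    then show ?case by (simp add: assms(1))
  next
    case (insert x S)
    from assms(2)[OF insert.IH] insert.hyps show ?case by (simp add: add.commute)
  qed
  moreover have "(\<Sum>x\<in>Poly_Mapping.keys p. Poly_Mapping.single x (Poly_Mapping.lookup p x)) = p"
    by (rule poly_mapping_eqI) (auto simp: lookup_sum lookup_single when_def in_keys_iff)
  ultimately show ?thesis by (metis finite_keys)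
qed

lemma tens_mult: "tens a b * tens a' b' = tens (a * a') (b' * b)"
proof (induction a rule: poly_mapping_induct_single)
  case zero
  then show ?case by simp
next
  case (add a u r)
  have "tens (Poly_Mapping.single u r) b * tens a' b' = tens (Poly_Mapping.single u r * a') (b' * b)"
  proof (induction b rule: poly_mapping_induct_single)
    case zero
    then show ?case by simp
  next
    case (add b v s)
    have "tens (Poly_Mapping.single u r) (Poly_Mapping.single v s) * tens a' b'
      = tens (Poly_Mapping.single u r * a') (b' * Poly_Mapping.single v s)"
    proof (induction a' rule: poly_mapping_induct_single)
      case zero
      then show ?case by simp
    next
      case (add a' u' r')
      have "tens (Poly_Mapping.single u r) (Poly_Mapping.single v s) * tens (Poly_Mapping.single u' r') b'
        = tens (Poly_Mapping.single u r * Poly_Mapping.single u' r') (b' * Poly_Mapping.single v s)"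
        by (induction b' rule: poly_mapping_induct_single)
          (simp_all add: tens_add_right distrib_left distrib_right tens_single mult_single
            plus_opp_def mult.assoc mult.left_commute mult.commute)
      with add show ?case by (simp add: tens_add_left distrib_left)
    qed
    with add show ?case by (simp add: tens_add_right distrib_left distrib_right)
  qed
  with add show ?case by (simp add: tens_add_left distrib_right)
qed

lifting_forget poly_mapping.lifting

section \<open>The quotient by the span of commutators\<close>

quotient_type (overloaded) ('m, 'k) cyc = "'m::monoid_add \<Rightarrow>\<^sub>0 'k::field" / "modrel {a * b - b * a | a b. True}"
  morphisms rep_cyc cyc
  by (rule equivp_modrel)

instantiation cyc :: (monoid_add, field) ab_group_add
begin
lift_definition zero_cyc :: "('a, 'b) cyc" is 0 .
lift_definition plus_cyc :: "('a, 'b) cyc \<Rightarrow> ('a, 'b) cyc \<Rightarrow> ('a, 'b) cyc" is "(+)" by (rule modrel_add)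
lift_definition minus_cyc :: "('a, 'b) cyc \<Rightarrow> ('a, 'b) cyc \<Rightarrow> ('a, 'b) cyc" is "(-)" by (rule modrel_diff)
lift_definition uminus_cyc :: "('a, 'b) cyc \<Rightarrow> ('a, 'b) cyc" is uminus by (rule modrel_uminus)
instance
  by standard (transfer; simp add: modrel_def free.span_zero algebra_simps)+
end

lift_definition scale_cyc :: "'k::field \<Rightarrow> ('m::monoid_add, 'k) cyc \<Rightarrow> ('m, 'k) cyc" is scal
  by (rule modrel_scal)

global_interpretation cyc: vector_space "scale_cyc :: 'k::field \<Rightarrow> ('m::monoid_add, 'k) cyc \<Rightarrow> _"
  by unfold_locales (transfer; simp add: modrel_def free.span_zero algebra_simps)+

section \<open>Noncommutative 1-forms\<close>

text \<open>The generator \<open>(a, b, c)\<close> stands for \<open>a (db) c\<close>.\<close>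

inductive_set omega_rels ::
    "(('m::monoid_add \<Rightarrow>\<^sub>0 'k::field) \<times> ('m \<Rightarrow>\<^sub>0 'k) \<times> ('m \<Rightarrow>\<^sub>0 'k) \<Rightarrow>\<^sub>0 'k) set" where
  add_left: "gen (a + a', b, c) - gen (a, b, c) - gen (a', b, c) \<in> omega_rels"
| add_mid: "gen (a, b + b', c) - gen (a, b, c) - gen (a, b', c) \<in> omega_rels"
| add_right: "gen (a, b, c + c') - gen (a, b, c) - gen (a, b, c') \<in> omega_rels"
| scal_left: "gen (scal r a, b, c) - scal r (gen (a, b, c)) \<in> omega_rels"
| scal_mid: "gen (a, scal r b, c) - scal r (gen (a, b, c)) \<in> omega_rels"
| scal_right: "gen (a, b, scal r c) - scal r (gen (a, b, c)) \<in> omega_rels"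
| leibniz: "gen (a, b * b', c) - gen (a, b, b' * c) - gen (a * b, b', c) \<in> omega_rels"

quotient_type (overloaded) ('m, 'k) omega =
  "(('m::monoid_add \<Rightarrow>\<^sub>0 'k::field) \<times> ('m \<Rightarrow>\<^sub>0 'k) \<times> ('m \<Rightarrow>\<^sub>0 'k)) \<Rightarrow>\<^sub>0 'k" / "modrel omega_rels"
  by (rule equivp_modrel)

instantiation omega :: (monoid_add, field) ab_group_add
begin
lift_definition zero_omega :: "('a, 'b) omega" is 0 .
lift_definition plus_omega :: "('a, 'b) omega \<Rightarrow> ('a, 'b) omega \<Rightarrow> ('a, 'b) omega" is "(+)" by (rule modrel_add)
lift_definition minus_omega :: "('a, 'b) omega \<Rightarrow> ('a, 'b) omega \<Rightarrow> ('a, 'b) omega" is "(-)" by (rule modrel_diff)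
lift_definition uminus_omega :: "('a, 'b) omega \<Rightarrow> ('a, 'b) omega" is uminus by (rule modrel_uminus)
instance
  by standard (transfer; simp add: modrel_def free.span_zero algebra_simps)+
end

lift_definition scale_omega :: "'k::field \<Rightarrow> ('m::monoid_add, 'k) omega \<Rightarrow> ('m, 'k) omega" is scal
  by (rule modrel_scal)

global_interpretation omega: vector_space "scale_omega :: 'k::field \<Rightarrow> ('m::monoid_add, 'k) omega \<Rightarrow> _"
  by unfold_locales (transfer; simp add: modrel_def free.span_zero algebra_simps)+

lemma scal_mult_left: "scal r a * b = scal r (a * b)"
  for a b :: "'m::monoid_add \<Rightarrow>\<^sub>0 'k::field"
  by (simp add: scal_def mult_map_scale_conv_mult mult.assoc)

lemma scal_mult_right: "a * scal r b = scal r (a * b)"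
  for a b :: "'m::monoid_add \<Rightarrow>\<^sub>0 'k::field"
proof -
  have "a * Poly_Mapping.single 0 r = Poly_Mapping.single 0 r * a"
    by (induction a rule: poly_mapping_induct_single)
      (simp_all add: distrib_left distrib_right mult_single mult.commute)
  then show ?thesis by (simp add: scal_def mult_map_scale_conv_mult flip: mult.assoc)
qed

lift_definition lmul :: "('m::monoid_add \<Rightarrow>\<^sub>0 'k::field) \<Rightarrow> ('m, 'k) omega \<Rightarrow> ('m, 'k) omega"
  is "\<lambda>x. fext (\<lambda>(a, b, c). gen (x * a, b, c))"
proof (erule modrel_fext[rotated], rule free.span_base, goal_cases)
  case (1 x p q g)
  then show ?case
    by cases (auto simp: distrib_left scal_mult_right mult.assoc[symmetric] intro: omega_rels.intros)
qed

lift_definition rmul :: "('m::monoid_add, 'k::field) omega \<Rightarrow> ('m \<Rightarrow>\<^sub>0 'k) \<Rightarrow> ('m, 'k) omega"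
  is "\<lambda>p x. fext (\<lambda>(a, b, c). gen (a, b, c * x)) p"
proof (erule modrel_fext[rotated], rule free.span_base, goal_cases)
  case (1 x p q g)
  then show ?case
    by cases (auto simp: distrib_right scal_mult_left mult.assoc intro: omega_rels.intros)
qed

lift_definition d :: "('m::monoid_add \<Rightarrow>\<^sub>0 'k::field) \<Rightarrow> ('m, 'k) omega" is "\<lambda>b. gen (1, b, 1)" .

lemma lmul_add: "lmul x (w + w') = lmul x w + lmul x w'"
  by transfer (simp add: modrel_def free.span_zero)

lemma lmul_scale: "lmul x (scale_omega r w) = scale_omega r (lmul x w)"
  by transfer (simp add: modrel_def free.span_zero)

lemma fext_fext: "fext h (fext h' p) = fext (\<lambda>x. fext h (h' x)) p"
proof -
  interpret Vector_Spaces.linear scal scal "fext h" by (rule fext_linear)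
  show ?thesis by (simp add: fext_def[of h'] fext_def[of "\<lambda>x. fext h (h' x)"] sum scale)
qed

lemma lmul_rmul: "lmul x (rmul w y) = rmul (lmul x w) y"
  by transfer (simp add: modrel_def free.span_zero fext_fext case_prod_unfold)

lifting_forget omega.lifting

text \<open>The left action of the enveloping algebra: \<open>tens a b\<close> sends \<open>m\<close> to \<open>a m b\<close>.\<close>

definition env_act :: "('m::monoid_add, 'k::field) env \<Rightarrow> ('m, 'k) omega \<Rightarrow> ('m, 'k) omega" where
  "env_act e m = (\<Sum>x\<in>Poly_Mapping.keys e. scale_omega (Poly_Mapping.lookup e x) (lmul (gen (fst x)) (rmul m (gen (unop (snd x))))))"

section \<open>Derivations, contraction and Lie derivative\<close>

definition Der :: "(('m::monoid_add \<Rightarrow>\<^sub>0 'k::field) \<Rightarrow> ('m \<Rightarrow>\<^sub>0 'k)) set" where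
  "Der = {f. Vector_Spaces.linear scal scal f \<and> (\<forall>a b. f (a * b) = f a * b + a * f b)}"

definition contraction ::
    "(('m::monoid_add \<Rightarrow>\<^sub>0 'k::field) \<Rightarrow> ('m \<Rightarrow>\<^sub>0 'k)) \<Rightarrow> ('m, 'k) omega \<Rightarrow> ('m \<Rightarrow>\<^sub>0 'k)" where
  "contraction f = (THE i. Vector_Spaces.linear scale_omega scal i
     \<and> (\<forall>x m. i (lmul x m) = x * i m) \<and> (\<forall>x m. i (rmul m x) = i m * x)
     \<and> (\<forall>b. i (d b) = f b))"

definition lie_derivative ::
    "(('m::monoid_add \<Rightarrow>\<^sub>0 'k::field) \<Rightarrow> ('m \<Rightarrow>\<^sub>0 'k)) \<Rightarrow> ('m, 'k) omega \<Rightarrow> ('m, 'k) omega" where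
  "lie_derivative f = (THE L. Vector_Spaces.linear scale_omega scale_omega L
     \<and> (\<forall>b b'. L (lmul b (d b')) = lmul (f b) (d b') + lmul b (d (f b'))))"

definition phi ::
    "(('m::monoid_add \<Rightarrow>\<^sub>0 'k::field) \<Rightarrow> ('m \<Rightarrow>\<^sub>0 'k)) \<Rightarrow> ('m, 'k) env \<Rightarrow> ('m, 'k) env" where
  "phi f = (THE D. Vector_Spaces.linear scal scal D
     \<and> (\<forall>a b. D (tens a b) = tens (f a) b + tens a (f b)))"

section \<open>The canonical flat connection\<close>

text \<open>
  \<open>omega_tens\<close> is the tensor product, over the enveloping algebra of \<open>B\<close>, of the 1-forms of the
  enveloping algebra with the 1-forms of \<open>B\<close>, where \<open>B\<close> is the monoid algebra of \<open>'m\<close>.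
\<close>

inductive_set omega_tens_rels ::
    "(('m::monoid_add \<times> 'm opp, 'k::field) omega \<times> ('m, 'k) omega \<Rightarrow>\<^sub>0 'k) set" where
  add_left: "gen (w + w', m) - gen (w, m) - gen (w', m) \<in> omega_tens_rels"
| add_right: "gen (w, m + m') - gen (w, m) - gen (w, m') \<in> omega_tens_rels"
| scale: "gen (scale_omega r w, m) - scal r (gen (w, m)) \<in> omega_tens_rels"
| balanced: "gen (rmul w e, m) - gen (w, env_act e m) \<in> omega_tens_rels"

quotient_type (overloaded) ('m, 'k) omega_tens =
  "(('m::monoid_add \<times> 'm opp, 'k::field) omega \<times> ('m, 'k) omega) \<Rightarrow>\<^sub>0 'k" / "modrel omega_tens_rels"
  by (rule equivp_modrel)

instantiation omega_tens :: (monoid_add, field) ab_group_add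
begin
lift_definition zero_omega_tens :: "('a, 'b) omega_tens" is 0 .
lift_definition plus_omega_tens :: "('a, 'b) omega_tens \<Rightarrow> ('a, 'b) omega_tens \<Rightarrow> ('a, 'b) omega_tens" is "(+)"
  by (rule modrel_add)
lift_definition minus_omega_tens :: "('a, 'b) omega_tens \<Rightarrow> ('a, 'b) omega_tens \<Rightarrow> ('a, 'b) omega_tens" is "(-)"
  by (rule modrel_diff)
lift_definition uminus_omega_tens :: "('a, 'b) omega_tens \<Rightarrow> ('a, 'b) omega_tens" is uminus
  by (rule modrel_uminus)
instance
  by standard (transfer; simp add: modrel_def free.span_zero algebra_simps)+
end

lift_definition scale_omega_tens ::
    "'k::field \<Rightarrow> ('m::monoid_add, 'k) omega_tens \<Rightarrow> ('m, 'k) omega_tens" is scal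
  by (rule modrel_scal)

global_interpretation omega_tens:
  vector_space "scale_omega_tens :: 'k::field \<Rightarrow> ('m::monoid_add, 'k) omega_tens \<Rightarrow> _"
  by unfold_locales (transfer; simp add: modrel_def free.span_zero algebra_simps)+

definition otimes ::
    "('m::monoid_add \<times> 'm opp, 'k::field) omega \<Rightarrow> ('m, 'k) omega \<Rightarrow> ('m, 'k) omega_tens" where
  "otimes w m = abs_omega_tens (gen (w, m))"

lift_definition lmul_tens ::
    "('m::monoid_add, 'k::field) env \<Rightarrow> ('m, 'k) omega_tens \<Rightarrow> ('m, 'k) omega_tens"
  is "\<lambda>x. fext (\<lambda>(w, m). gen (lmul x w, m))"
proof (erule modrel_fext[rotated], rule free.span_base, goal_cases)
  case (1 x p q g)
  then show ?case
    by cases (auto simp: lmul_add lmul_scale lmul_rmul intro: omega_tens_rels.intros)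
qed

definition nabla :: "('n fmon, 'k) omega \<Rightarrow> ('n::finite fmon, 'k::field) omega_tens" where
  "nabla = (THE N. Vector_Spaces.linear scale_omega scale_omega_tens N
     \<and> (\<forall>b m. N (env_act b m) = otimes (d b) m + lmul_tens b (N m))
     \<and> (\<forall>w :: 'k ^ 'n. N (d (incl w)) = 0))"

text \<open>
  The map \<open>i \<otimes> id\<close> for a bimodule map \<open>i\<close> from the 1-forms of the enveloping algebra to the
  enveloping algebra, followed by the identification given by the module action.
\<close>

definition tens_id ::
    "(('m::monoid_add \<times> 'm opp, 'k::field) omega \<Rightarrow> ('m, 'k) env) \<Rightarrow> ('m, 'k) omega_tens \<Rightarrow> ('m, 'k) omega" where
  "tens_id i = (THE g. Vector_Spaces.linear scale_omega_tens scale_omega g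
     \<and> (\<forall>w m. g (otimes w m) = env_act (i w) m))"

definition c_nabla ::
    "(('n, 'k) talg \<Rightarrow> ('n, 'k) talg) \<Rightarrow> ('n::finite fmon, 'k::field) omega \<Rightarrow> ('n fmon, 'k) omega" where
  "c_nabla f m = tens_id (contraction (phi f)) (nabla m) - lie_derivative f m"

section \<open>Trace\<close>

definition dual_omega :: "(('m::monoid_add, 'k::field) omega \<Rightarrow> ('m, 'k) env) set" where
  "dual_omega = {\<mu>. Vector_Spaces.linear scale_omega scal \<mu> \<and> (\<forall>e m. \<mu> (env_act e m) = e * \<mu> m)}"

text \<open>
  An endomorphism of the 1-forms of \<open>T(W)\<close> corresponds to a tensor \<open>\<Sum> \<mu> \<otimes> m\<close> when it sends \<open>x\<close> to
  \<open>\<Sum> \<mu>(x) m\<close>; the trace of this tensor is \<open>\<Sum> |\<mu>(m)|\<close>.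
\<close>

definition Tr :: "(('n fmon, 'k) omega \<Rightarrow> ('n fmon, 'k) omega)
    \<Rightarrow> ('n::finite fmon \<times> 'n fmon opp, 'k::field) cyc" where
  "Tr \<phi> = (THE t. \<exists>ps. (\<forall>(\<mu>, m) \<in> set ps. \<mu> \<in> dual_omega)
     \<and> (\<forall>x. \<phi> x = (\<Sum>(\<mu>, m)\<leftarrow>ps. env_act (\<mu> x) m))
     \<and> t = (\<Sum>(\<mu>, m)\<leftarrow>ps. cyc (\<mu> m)))"

section \<open>Chevalley--Eilenberg cohomology\<close>

text \<open>
  The parameters are the carrier \<open>G\<close> of the Lie algebra, its scalar multiplication \<open>sG\<close> and bracket
  \<open>br\<close>, the scalar multiplication \<open>sM\<close> of the module and the action \<open>act\<close>. A \<open>k\<close>-cochain is an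
  alternating multilinear map on lists of length \<open>k\<close> over \<open>G\<close>; it is 0 on all other lists, so that
  equality of cochains is equality of functions.
\<close>

definition tuples :: "'g set \<Rightarrow> nat \<Rightarrow> 'g list set" where
  "tuples G k = {xs. length xs = k \<and> set xs \<subseteq> G}"

definition CE_cochains :: "'g::ab_group_add set \<Rightarrow> ('k \<Rightarrow> 'g \<Rightarrow> 'g) \<Rightarrow> ('k \<Rightarrow> 'm::ab_group_add \<Rightarrow> 'm)
    \<Rightarrow> nat \<Rightarrow> ('g list \<Rightarrow> 'm) set" where
  "CE_cochains G sG sM k = {\<beta>.
     (\<forall>xs. xs \<notin> tuples G k \<longrightarrow> \<beta> xs = 0)
   \<and> (\<forall>xs\<in>tuples G k. \<forall>i<k. \<forall>x\<in>G. \<forall>y\<in>G. \<beta> (xs[i := x + y]) = \<beta> (xs[i := x]) + \<beta> (xs[i := y]))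
   \<and> (\<forall>xs\<in>tuples G k. \<forall>i<k. \<forall>x\<in>G. \<forall>r. \<beta> (xs[i := sG r x]) = sM r (\<beta> (xs[i := x])))
   \<and> (\<forall>xs\<in>tuples G k. \<not> distinct xs \<longrightarrow> \<beta> xs = 0)}"

definition CE_diff :: "'g set \<Rightarrow> ('k::field \<Rightarrow> 'm::ab_group_add \<Rightarrow> 'm) \<Rightarrow> ('g \<Rightarrow> 'g \<Rightarrow> 'g) \<Rightarrow> ('g \<Rightarrow> 'm \<Rightarrow> 'm)
    \<Rightarrow> nat \<Rightarrow> ('g list \<Rightarrow> 'm) \<Rightarrow> ('g list \<Rightarrow> 'm)" where
  "CE_diff G sM br act k \<beta> xs = (if xs \<in> tuples G (Suc k) then
       (\<Sum>i\<le>k. sM ((-1) ^ i) (act (xs ! i) (\<beta> (nths xs (- {i})))))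
     + (\<Sum>j\<le>k. \<Sum>i<j. sM ((-1) ^ (i + j)) (\<beta> (br (xs ! i) (xs ! j) # nths xs (- {i, j}))))
     else 0)"

fun CE_coboundaries :: "'g::ab_group_add set \<Rightarrow> ('k::field \<Rightarrow> 'g \<Rightarrow> 'g) \<Rightarrow> ('k \<Rightarrow> 'm::ab_group_add \<Rightarrow> 'm)
    \<Rightarrow> ('g \<Rightarrow> 'g \<Rightarrow> 'g) \<Rightarrow> ('g \<Rightarrow> 'm \<Rightarrow> 'm) \<Rightarrow> nat \<Rightarrow> ('g list \<Rightarrow> 'm) set" where
  "CE_coboundaries G sG sM br act 0 = {0}"
| "CE_coboundaries G sG sM br act (Suc k) = CE_diff G sM br act k ` CE_cochains G sG sM k"

text \<open>The cohomology class of a cocycle \<open>\<eta>\<close> is its coset modulo the coboundaries.\<close>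

definition CE_class :: "'g::ab_group_add set \<Rightarrow> ('k::field \<Rightarrow> 'g \<Rightarrow> 'g) \<Rightarrow> ('k \<Rightarrow> 'm::ab_group_add \<Rightarrow> 'm)
    \<Rightarrow> ('g \<Rightarrow> 'g \<Rightarrow> 'g) \<Rightarrow> ('g \<Rightarrow> 'm \<Rightarrow> 'm) \<Rightarrow> nat \<Rightarrow> ('g list \<Rightarrow> 'm) \<Rightarrow> ('g list \<Rightarrow> 'm) set" where
  "CE_class G sG sM br act k \<eta> = {\<eta> + \<beta> | \<beta>. \<beta> \<in> CE_coboundaries G sG sM br act k}"

section \<open>The classes of the powers of the connection cochain\<close>

definition scale_der :: "'k::field \<Rightarrow> (('m \<Rightarrow>\<^sub>0 'k) \<Rightarrow> ('m \<Rightarrow>\<^sub>0 'k)) \<Rightarrow> (('m \<Rightarrow>\<^sub>0 'k) \<Rightarrow> ('m \<Rightarrow>\<^sub>0 'k))" where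
  "scale_der r f a = scal r (f a)"

definition bracket_der :: "(('m \<Rightarrow>\<^sub>0 'k::field) \<Rightarrow> ('m \<Rightarrow>\<^sub>0 'k)) \<Rightarrow> (('m \<Rightarrow>\<^sub>0 'k) \<Rightarrow> ('m \<Rightarrow>\<^sub>0 'k))
    \<Rightarrow> (('m \<Rightarrow>\<^sub>0 'k) \<Rightarrow> ('m \<Rightarrow>\<^sub>0 'k))" where
  "bracket_der f g a = f (g a) - g (f a)"

definition act_der :: "(('m::monoid_add \<Rightarrow>\<^sub>0 'k::field) \<Rightarrow> ('m \<Rightarrow>\<^sub>0 'k))
    \<Rightarrow> ('m \<times> 'm opp, 'k) cyc \<Rightarrow> ('m \<times> 'm opp, 'k) cyc" where
  "act_der f t = (THE s. \<forall>b. cyc b = t \<longrightarrow> s = cyc (phi f b))"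

abbreviation class_Der :: "nat \<Rightarrow> ((('n, 'k) talg \<Rightarrow> ('n, 'k) talg) list \<Rightarrow> ('n fmon \<times> 'n fmon opp, 'k::field) cyc)
    \<Rightarrow> ((('n, 'k) talg \<Rightarrow> ('n, 'k) talg) list \<Rightarrow> ('n fmon \<times> 'n fmon opp, 'k) cyc) set" where
  "class_Der \<equiv> CE_class Der scale_der scale_cyc bracket_der act_der"

definition Tr_c_power :: "nat \<Rightarrow> (('n, 'k) talg \<Rightarrow> ('n, 'k) talg) list
    \<Rightarrow> ('n::finite fmon \<times> 'n fmon opp, 'k::field) cyc" where
  "Tr_c_power k fs = (if fs \<in> tuples Der k then
      (\<Sum>s | s permutes {..<k}.
        scale_cyc (of_int (sign s)) (Tr (foldr (\<lambda>i g. c_nabla (fs ! s i) \<circ> g) [0..<k] id)))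
    else 0)"

end

theory Submission
  imports Defs
begin

text \<open>
  Write \<open>A\<close> for the tensor algebra. The connection kills the basis \<open>dw\<close> of the 1-forms, so \<open>c_nabla f\<close>
  is minus the noncommutative Jacobian matrix of the derivation \<open>f\<close> (\<open>c_nabla\<close>), and the trace is the
  sum of the diagonal entries modulo commutators (\<open>Tr_coord\<close>).

  Every term of a coboundary \<open>(d\<beta>)(f\<^sub>1, \<dots>, f\<^sub>k)\<close> contains a bracket of two of the \<open>f\<^sub>i\<close> or a value on
  which one of the \<open>f\<^sub>i\<close> acts. Hence a class is nonzero as soon as there are commuting derivations and
  a linear functional on \<open>|A\<^sup>e|\<close> that kills \<open>f\<^sub>i \<cdot> |A\<^sup>e|\<close> for each \<open>i\<close>, but not the value of the cocycle
  at them (\<open>coboundary_vanishes\<close>). If the Jacobians commute, the antisymmetrised product is 0 for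
  \<open>k > 1\<close>; so the task is to find commuting derivations with noncommuting Jacobians.

  For two letters \<open>x \<noteq> y\<close> let \<open>F\<^sub>i\<close> be the derivation with \<open>x \<mapsto> x y^i x\<close> that kills the other letters, for
  \<open>0 \<le> i < k\<close>. These commute, because \<open>F\<^sub>i (F\<^sub>j x) = x y^i x y^j x + x y^j x y^i x\<close> is symmetric
  (\<open>quad_commute\<close>). The Jacobian of \<open>F\<^sub>i\<close> has \<open>(x, x)\<close> entry \<open>1 \<otimes> y^i x + x y^i \<otimes> 1\<close>, and these entries do
  not commute.

  For the functional, apply the augmentation to the right factor of \<open>A\<^sup>e\<close>, and send the cyclic word
  \<open>x y^a\<^sub>1 x y^a\<^sub>2 \<dots> x y^a\<^sub>k\<close> to the sign of
  \<open>a\<close>, read from right to left, as a permutation of \<open>0, \<dots>, k - 1\<close>, and to 0 if \<open>a\<close> is not one.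
  The parity of \<open>k\<close> enters twice. Rotations of a list of odd length are even permutations, so the
  functional is defined on cyclic words (\<open>cyc_alt_commute\<close>). And \<open>F\<^sub>i\<close> inserts a gap of length \<open>i\<close> at each
  of the \<open>k - 1\<close> places of a cyclic word with \<open>k - 1\<close> gaps; the resulting signs alternate and their
  number is even, so they cancel (\<open>sum_cyc_alt_ins\<close>, \<open>Alt_phi_quad\<close>).

  On \<open>Tr(c\<^sup>k)(F\<^sub>0, \<dots>, F\<^sub>k\<^sub>-\<^sub>1)\<close> only the summands \<open>x y^i \<otimes> 1\<close> of the Jacobians survive, and each of the \<open>k!\<close>
  permutations contributes its own sign twice, up to the common sign \<open>(-1)\<^sup>k\<close>. The value is \<open>- k!\<close>, which
  is nonzero in characteristic zero (\<open>sum_alt\<close>).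
\<close>

section \<open>Linear maps out of free vector spaces and their quotients\<close>

abbreviation lin where "lin \<equiv> Vector_Spaces.linear"

lemma lin_add: "lin s t f \<Longrightarrow> f (x + y) = f x + f y"
  and lin_scale: "lin s t f \<Longrightarrow> f (s r x) = t r (f x)"
  by (auto simp: Vector_Spaces.linear_iff)

lemma lin_zero: "lin s t f \<Longrightarrow> f 0 = 0"
  using lin_add[of s t f 0 0] by simp

lemma lin_diff: "lin s t f \<Longrightarrow> f (x - y) = f x - f y"
  using lin_add[of s t f "x - y" y] by simp

lemma lin_sum: "lin s t f \<Longrightarrow> f (sum g A) = (\<Sum>i\<in>A. f (g i))"
  by (induction A rule: infinite_finite_induct) (auto simp: lin_zero lin_add)

lemma lin_sum_list: "lin s t f \<Longrightarrow> f (sum_list xs) = (\<Sum>i\<leftarrow>xs. f i)"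
  by (induction xs) (auto simp: lin_zero lin_add)

lemma lin_comp: "lin s t f \<Longrightarrow> lin t u g \<Longrightarrow> lin s u (\<lambda>x. g (f x))"
  by (simp add: Vector_Spaces.linear_iff)

lemma lin_plus:
  assumes "lin s t f" "lin s t g"
  shows "lin s t (\<lambda>x. f x + g x)"
proof -
  interpret vector_space t using assms by (simp add: Vector_Spaces.linear_iff)
  from assms show ?thesis by (simp add: Vector_Spaces.linear_iff scale_right_distrib)
qed

lemma lin_minus:
  assumes "lin s t f" "lin s t g"
  shows "lin s t (\<lambda>x. f x - g x)"
proof -
  interpret vector_space t using assms by (simp add: Vector_Spaces.linear_iff)
  from assms show ?thesis by (simp add: Vector_Spaces.linear_iff scale_right_diff_distrib)
qed

lemma lin_const_zero:
  assumes "vector_space s" "vector_space t"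
  shows "lin s t (\<lambda>x. 0)"
proof -
  interpret vector_space t by fact
  from assms show ?thesis by (simp add: Vector_Spaces.linear_iff)
qed

lemma lin_setsum:
  "vector_space s \<Longrightarrow> vector_space t \<Longrightarrow> (\<And>i. lin s t (f i)) \<Longrightarrow> lin s t (\<lambda>x. \<Sum>i\<in>A. f i x)"
  by (induction A rule: infinite_finite_induct) (simp_all add: lin_const_zero lin_plus)

text \<open>
  The values of \<open>fext\<close> lie in a free vector space; here they may lie in any vector space, in
  particular in the quotients by relations.
\<close>

definition lext :: "('k::field \<Rightarrow> 'v::ab_group_add \<Rightarrow> 'v) \<Rightarrow> ('x \<Rightarrow> 'v) \<Rightarrow> ('x \<Rightarrow>\<^sub>0 'k) \<Rightarrow> 'v" where
  "lext s h p = (\<Sum>x\<in>Poly_Mapping.keys p. s (Poly_Mapping.lookup p x) (h x))"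

context vector_space
begin

lemma lext_superset:
  assumes "finite S" "Poly_Mapping.keys p \<subseteq> S"
  shows "lext scale h p = (\<Sum>x\<in>S. scale (Poly_Mapping.lookup p x) (h x))"
  unfolding lext_def by (rule sum.mono_neutral_left) (use assms in \<open>auto simp: in_keys_iff\<close>)

lemma lext_single [simp]: "lext scale h (Poly_Mapping.single x r) = scale r (h x)"
  by (simp add: lext_superset[of "{x}"])

lemma linear_lext:
  fixes h :: "'x \<Rightarrow> 'b"
  shows "lin scal scale (lext scale h)"
  unfolding Vector_Spaces.linear_iff
proof (intro conjI allI)
  show "vector_space scal" by (rule free.vector_space_axioms)
  show "vector_space scale" by (rule vector_space_axioms)
  fix p q :: "'x \<Rightarrow>\<^sub>0 'a" and r
  have "Poly_Mapping.keys (p + q) \<subseteq> Poly_Mapping.keys p \<union> Poly_Mapping.keys q" by (rule Poly_Mapping.keys_add)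
  then show "lext scale h (p + q) = lext scale h p + lext scale h q"
    by (simp add: lext_superset[of "Poly_Mapping.keys p \<union> Poly_Mapping.keys q"] lookup_add scale_left_distrib sum.distrib)
  have "Poly_Mapping.keys (scal r p) \<subseteq> Poly_Mapping.keys p" by (auto simp: in_keys_iff)
  then show "lext scale h (scal r p) = scale r (lext scale h p)"
    by (simp add: lext_superset[of "Poly_Mapping.keys p"] scale_sum_right)
qed

lemma lext_zero_on_span:
  assumes "\<And>x. x \<in> R \<Longrightarrow> lext scale h x = 0" "p \<in> free.span R"
  shows "lext scale h p = 0"
  using assms(2)
  by (induction rule: free.span_induct_alt)
    (auto simp: lin_zero[OF linear_lext] lin_add[OF linear_lext] lin_scale[OF linear_lext] assms(1))

end

lemma free_ext:
  assumes "lin scal s f" "lin scal s g" "\<And>x. f (gen x) = g (gen x)"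
  shows "f p = g p"
proof (induction p rule: poly_mapping_induct_single)
  case zero
  then show ?case by (simp add: lin_zero[OF assms(1)] lin_zero[OF assms(2)])
next
  case (add p x r)
  have "f (scal r (gen x)) = g (scal r (gen x))"
    by (simp only: lin_scale[OF assms(1)] lin_scale[OF assms(2)] assms(3))
  then have "f (Poly_Mapping.single x r) = g (Poly_Mapping.single x r)"
    by (simp only: scal_gen)
  with add show ?case by (simp add: lin_add[OF assms(1)] lin_add[OF assms(2)])
qed

text \<open>
  The 1-forms, their tensor product and the cyclic quotient are all quotients of a free vector space
  by the span of a set \<open>R\<close> of relations. This is their common universal property: a map on the
  generators that kills \<open>R\<close> extends to the quotient, and only in one way.
\<close>

lemma (in vector_space) quotient_lift:
  assumes Q: "Quotient3 (modrel R) Abs Rep"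
    and zero: "\<And>x. x \<in> R \<Longrightarrow> lext scale h x = 0"
    and add: "\<And>p q. Abs p + Abs q = Abs (p + q)" and sc: "\<And>r p. sQ r (Abs p) = Abs (scal r p)"
    and "vector_space sQ"
  shows "lin sQ scale (\<lambda>m. lext scale h (Rep m))" "lext scale h (Rep (Abs p)) = lext scale h p"
proof -
  have *: "lext scale h (Rep (Abs p)) = lext scale h p" for p
  proof -
    have "modrel R (Rep (Abs p)) p"
      by (rule Quotient3_rep_abs[OF Q]) (rule equivp_reflp[OF equivp_modrel])
    then have "lext scale h (Rep (Abs p) - p) = 0"
      unfolding modrel_def using lext_zero_on_span[of R] zero by blast
    then show ?thesis by (simp add: lin_diff[OF linear_lext])
  qed
  show "lext scale h (Rep (Abs p)) = lext scale h p" by (rule *)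
  have "lext scale h (Rep (m + m')) = lext scale h (Rep m) + lext scale h (Rep m')" for m m'
    using *[of "Rep m + Rep m'"]
    by (simp add: add[symmetric] lin_add[OF linear_lext] Quotient3_abs_rep[OF Q])
  moreover have "lext scale h (Rep (sQ r m)) = scale r (lext scale h (Rep m))" for r m
    using *[of "scal r (Rep m)"]
    by (simp add: sc[symmetric] lin_scale[OF linear_lext] Quotient3_abs_rep[OF Q])
  ultimately show "lin sQ scale (\<lambda>m. lext scale h (Rep m))"
    by (simp add: Vector_Spaces.linear_iff vector_space_axioms assms(5))
qed

lemma quotient_ext:
  assumes Q: "Quotient3 (modrel R) Abs Rep"
    and add: "\<And>p q. Abs p + Abs q = Abs (p + q)" and sc: "\<And>r p. sQ r (Abs p) = Abs (scal r p)"
    and f: "lin sQ s f" "lin sQ s g" and eq: "\<And>x. f (Abs (gen x)) = g (Abs (gen x))"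
  shows "f m = g m"
proof -
  have "lin scal sQ Abs"
    using f by (simp add: Vector_Spaces.linear_iff free.vector_space_axioms add sc)
  from free_ext[OF lin_comp[OF this f(1)] lin_comp[OF this f(2)], of "Rep m"] eq
  show ?thesis by (simp add: Quotient3_abs_rep[OF Q])
qed

section \<open>1-forms and the action of the enveloping algebra\<close>

text \<open>The 1-form \<open>a (db) c\<close>.\<close>

definition elt :: "('m::monoid_add \<Rightarrow>\<^sub>0 'k::field) \<Rightarrow> ('m \<Rightarrow>\<^sub>0 'k) \<Rightarrow> ('m \<Rightarrow>\<^sub>0 'k) \<Rightarrow> ('m, 'k) omega" where
  "elt a b c = abs_omega (gen (a, b, c))"

lemma abs_omega_eqI: "p - q \<in> omega_rels \<Longrightarrow> abs_omega p = abs_omega q"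
  using Quotient3_rel_abs[OF Quotient3_omega, of p q] by (simp add: modrel_def free.span_base)

lemma elt_add_left: "elt (a + a') b c = elt a b c + elt a' b c"
  and elt_add_mid: "elt a (b + b') c = elt a b c + elt a b' c"
  and elt_add_right: "elt a b (c + c') = elt a b c + elt a b c'"
  and elt_scal_left: "elt (scal r a) b c = scale_omega r (elt a b c)"
  and elt_scal_mid: "elt a (scal r b) c = scale_omega r (elt a b c)"
  and elt_scal_right: "elt a b (scal r c) = scale_omega r (elt a b c)"
  and elt_leibniz: "elt a (b * b') c = elt a b (b' * c) + elt (a * b) b' c"
  unfolding elt_def plus_omega.abs_eq scale_omega.abs_eq
  by (rule abs_omega_eqI, simp add: diff_diff_eq[symmetric] omega_rels.intros)+

lemma lmul_elt: "lmul x (elt a b c) = elt (x * a) b c"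
  and rmul_elt: "rmul (elt a b c) x = elt a b (c * x)"
  by (simp_all add: elt_def lmul.abs_eq rmul.abs_eq)

lemma d_elt: "d b = elt 1 b 1"
  by (simp add: elt_def d.abs_eq)

lemma elt_alt: "elt a b c = lmul a (rmul (d b) c)"
  by (simp add: d_elt lmul_elt rmul_elt)

lemma omega_ext:
  assumes "lin scale_omega s f" "lin scale_omega s g" "\<And>a b c. f (elt a b c) = g (elt a b c)"
  shows "f m = g m"
  by (rule quotient_ext[OF Quotient3_omega plus_omega.abs_eq scale_omega.abs_eq assms(1,2)])
    (metis assms(3) elt_def prod_cases3)

text \<open>
  This is the source of all operators on 1-forms below: a trilinear map that obeys the Leibniz rule
  in the middle argument kills the relations.
\<close>

lemma (in vector_space) omega_lift:
  fixes h :: "('m::monoid_add \<Rightarrow>\<^sub>0 'a) \<Rightarrow> ('m \<Rightarrow>\<^sub>0 'a) \<Rightarrow> ('m \<Rightarrow>\<^sub>0 'a) \<Rightarrow> 'b"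
  assumes "\<And>a a' b c. h (a + a') b c = h a b c + h a' b c"
    "\<And>a b b' c. h a (b + b') c = h a b c + h a b' c"
    "\<And>a b c c'. h a b (c + c') = h a b c + h a b c'"
    "\<And>r a b c. h (scal r a) b c = scale r (h a b c)"
    "\<And>r a b c. h a (scal r b) c = scale r (h a b c)"
    "\<And>r a b c. h a b (scal r c) = scale r (h a b c)"
    "\<And>a b b' c. h a (b * b') c = h a b (b' * c) + h (a * b) b' c"
  obtains g where "lin scale_omega scale g" "\<And>a b c. g (elt a b c) = h a b c"
proof -
  let ?l = "lext scale (\<lambda>(a, b, c). h a b c)"
  have zero: "?l x = 0" if "x \<in> omega_rels" for x
    using that
    by cases (simp_all add: lin_diff[OF linear_lext] lin_scale[OF linear_lext] assms)
  note lift = quotient_lift[OF Quotient3_omega _ plus_omega.abs_eq scale_omega.abs_eq omega.vector_space_axioms]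
  show ?thesis
  proof (rule that)
    show "lin scale_omega scale (\<lambda>m. ?l (rep_omega m))"
      by (rule lift(1)) (rule zero)
    show "?l (rep_omega (elt a b c)) = h a b c" for a b c
      unfolding elt_def by (subst lift(2)) (simp_all add: zero)
  qed
qed

lemma lin_mult_left: "lin scal scal (\<lambda>x. a * x)"
  and lin_mult_right: "lin scal scal (\<lambda>x. x * a)" for a :: "'m::monoid_add \<Rightarrow>\<^sub>0 'k::field"
  by (auto simp: Vector_Spaces.linear_iff free.vector_space_axioms distrib_left distrib_right
    scal_mult_left scal_mult_right)

lemma lin_tens_left: "lin scal scal (\<lambda>a. tens a b)"
  and lin_tens_right: "lin scal scal (\<lambda>b. tens a b)"
  by (auto simp: Vector_Spaces.linear_iff free.vector_space_axioms tens_add_left tens_add_right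
    tens_scal_left tens_scal_right)

lemma lin_elt_left: "lin scal scale_omega (\<lambda>a. elt a b c)"
  and lin_elt_mid: "lin scal scale_omega (\<lambda>b. elt a b c)"
  and lin_elt_right: "lin scal scale_omega (\<lambda>c. elt a b c)"
  by (auto simp: Vector_Spaces.linear_iff free.vector_space_axioms omega.vector_space_axioms
    elt_add_left elt_add_mid elt_add_right elt_scal_left elt_scal_mid elt_scal_right)

lemma lin_d: "lin scal scale_omega d"
  using lin_elt_mid[of 1 1] by (simp add: d_elt[symmetric])

lemma lin_lmul: "lin scale_omega scale_omega (lmul x)"
  by (auto simp: Vector_Spaces.linear_iff omega.vector_space_axioms lmul_add lmul_scale)

lemma abs_rep_omega: "abs_omega (rep_omega m) = m"
  by (rule Quotient3_abs_rep[OF Quotient3_omega])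

lemma lin_rmul: "lin scale_omega scale_omega (\<lambda>m. rmul m x)"
proof -
  have "rmul (abs_omega p + abs_omega q) x = rmul (abs_omega p) x + rmul (abs_omega q) x"
    "rmul (scale_omega r (abs_omega p)) x = scale_omega r (rmul (abs_omega p) x)" for p q r
    by (simp_all add: rmul.abs_eq plus_omega.abs_eq scale_omega.abs_eq)
  then have "rmul (m + m') x = rmul m x + rmul m' x" "rmul (scale_omega r m) x = scale_omega r (rmul m x)" for m m' r
    by (metis abs_rep_omega)+
  then show ?thesis
    by (simp add: Vector_Spaces.linear_iff omega.vector_space_axioms)
qed

lemma tens_gen: "tens (gen u) (gen v) = gen (u, Op v)"
  by (simp add: tens_single)

lemma one_env: "(1 :: ('m::monoid_add, 'k::field) env) = tens 1 1"
  by (simp add: tens_gen flip: single_one) (simp add: zero_prod_def zero_opp_def)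

lemma env_ext:
  fixes f g :: "('m::monoid_add, 'k::field) env \<Rightarrow> 'v::ab_group_add"
  assumes "lin scal s f" "lin scal s g" "\<And>a b. f (tens a b) = g (tens a b)"
  shows "f e = g e"
proof (rule free_ext[OF assms(1,2)])
  fix z :: "'m \<times> 'm opp"
  obtain u v where "z = (u, Op v)" by (metis opp.exhaust surj_pair)
  then show "f (gen z) = g (gen z)" using assms(3)[of "gen u" "gen v"] by (simp add: tens_gen)
qed

lemma env_act_lext:
  "env_act e m = lext scale_omega (\<lambda>z. lmul (gen (fst z)) (rmul m (gen (unop (snd z))))) e"
  by (simp add: env_act_def lext_def)

lemma lin_env_act_left: "lin scal scale_omega (\<lambda>e. env_act e m)"
  unfolding env_act_lext by (rule omega.linear_lext)

lemma lin_env_act_right: "lin scale_omega scale_omega (env_act e)"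
  by (simp add: Vector_Spaces.linear_iff omega.vector_space_axioms env_act_def sum.distrib
    omega.scale_right_distrib omega.scale_sum_right mult.commute lin_add[OF lin_rmul] lin_add[OF lin_lmul]
    lin_scale[OF lin_rmul] lin_scale[OF lin_lmul])

lemma env_act_elt: "env_act (tens a b) (elt p q r) = elt (a * p) q (r * b)"
proof -
  have "env_act (tens a b) (elt p q r) = elt (a * p) q (r * b)" if b: "b = gen v" for a b v
  proof (rule free_ext[where s = scale_omega and f = "\<lambda>a. env_act (tens a b) (elt p q r)" and g = "\<lambda>a. elt (a * p) q (r * b)"])
    show "lin scal scale_omega (\<lambda>a. env_act (tens a b) (elt p q r))"
      by (rule lin_comp[OF lin_tens_left lin_env_act_left])
    show "lin scal scale_omega (\<lambda>a. elt (a * p) q (r * b))"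
      by (rule lin_comp[OF lin_mult_right lin_elt_left])
  qed (simp add: b tens_gen env_act_lext lmul_elt rmul_elt)
  then show ?thesis
    by (rule free_ext[where s = scale_omega and f = "\<lambda>b. env_act (tens a b) (elt p q r)" and g = "\<lambda>b. elt (a * p) q (r * b)",
        OF lin_comp[OF lin_tens_right lin_env_act_left] lin_comp[OF lin_mult_left lin_elt_right]]) auto
qed

lemma env_act_tens: "env_act (tens a b) m = lmul a (rmul m b)"
  by (rule omega_ext[OF lin_env_act_right lin_comp[OF lin_rmul lin_lmul]])
    (simp add: env_act_elt lmul_elt rmul_elt)

text \<open>
  The reversed multiplication in the opposite factor is what makes the two-sided action a left
  module structure.
\<close>

lemma env_act_mult: "env_act (e * e') m = env_act e (env_act e' m)"
proof -
  have *: "env_act (tens a b * tens a' b') (elt p q r) = env_act (tens a b) (env_act (tens a' b') (elt p q r))"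
    for a b a' b' p q r
    by (simp add: tens_mult env_act_elt mult.assoc)
  have *: "env_act (tens a b * tens a' b') m = env_act (tens a b) (env_act (tens a' b') m)" for a b a' b'
    by (rule omega_ext[OF lin_env_act_right lin_comp[OF lin_env_act_right lin_env_act_right]]) (rule *)
  have *: "env_act (tens a b * e') m = env_act (tens a b) (env_act e' m)" for a b
    by (rule env_ext[where s = scale_omega and f = "\<lambda>e'. env_act (tens a b * e') m" and g = "\<lambda>e'. env_act (tens a b) (env_act e' m)"])
      (intro lin_comp[OF lin_mult_left lin_env_act_left] lin_comp[OF lin_env_act_left lin_env_act_right] *)+
  show ?thesis
    by (rule env_ext[where s = scale_omega and f = "\<lambda>e. env_act (e * e') m" and g = "\<lambda>e. env_act e (env_act e' m)"])
      (intro lin_comp[OF lin_mult_right lin_env_act_left] lin_env_act_left *)+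
qed

lemma elt_env_act: "elt a b c = env_act (tens a c) (d b)"
  by (simp add: env_act_tens elt_alt)

lemma d_mult: "d (a * b) = rmul (d a) b + lmul a (d b)"
  using elt_leibniz[of 1 a b 1] by (simp add: d_elt lmul_elt rmul_elt)

lemma d_one: "d 1 = 0"
  using d_mult[of 1 1] by (simp add: d_elt rmul_elt lmul_elt)

section \<open>The operators attached to a derivation\<close>

lemma Der_lin: "f \<in> Der \<Longrightarrow> lin scal scal f"
  and Der_mult: "f \<in> Der \<Longrightarrow> f (a * b) = f a * b + a * f b"
  by (auto simp: Der_def)

lemma Der_one: "f \<in> Der \<Longrightarrow> f 1 = 0"
  using Der_mult[of f 1 1] by simp

text \<open>
  The operators of a derivation are given by descriptions, so each of them has to be constructed and
  shown to be unique before its defining equations can be used.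
\<close>

lemma phi_exists:
  assumes "f \<in> Der"
  obtains D where "lin scal scal D" "\<And>a b. D (tens a b) = tens (f a) b + tens a (f b)"
proof -
  define D where "D = lext scal (\<lambda>(u, v). tens (f (gen u)) (gen (unop v)) + tens (gen u) (f (gen (unop v))))"
  have lin: "lin scal scal D"
    unfolding D_def by (rule free.linear_lext)
  have D_gen: "D (gen (u, Op v)) = tens (f (gen u)) (gen v) + tens (gen u) (f (gen v))" for u v
    by (simp add: D_def)
  have *: "D (tens a (gen v)) = tens (f a) (gen v) + tens a (f (gen v))" for a v
    by (rule free_ext[where s = scal and f = "\<lambda>a. D (tens a (gen v))" and g = "\<lambda>a. tens (f a) (gen v) + tens a (f (gen v))"])
      (auto intro!: lin_comp[OF lin_tens_left lin] lin_plus lin_tens_left lin_comp[OF Der_lin[OF assms] lin_tens_left]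
        simp: tens_gen D_gen)
  have "D (tens a b) = tens (f a) b + tens a (f b)" for a b
    by (rule free_ext[where s = scal and f = "\<lambda>b. D (tens a b)" and g = "\<lambda>b. tens (f a) b + tens a (f b)"])
      (auto intro!: lin_comp[OF lin_tens_right lin] lin_plus lin_tens_right lin_comp[OF Der_lin[OF assms] lin_tens_right]
        simp: *)
  with lin show ?thesis by (rule that)
qed

lemma phi:
  assumes "f \<in> Der"
  shows lin_phi: "lin scal scal (phi f)"
    and phi_tens: "phi f (tens a b) = tens (f a) b + tens a (f b)"
proof -
  obtain D where D: "lin scal scal D" "\<And>a b. D (tens a b) = tens (f a) b + tens a (f b)"
    using phi_exists[OF assms] by blast
  have "phi f = D"
    unfolding phi_def
  proof (rule the_equality)
    fix D' assume D': "lin scal scal D' \<and> (\<forall>a b. D' (tens a b) = tens (f a) b + tens a (f b))"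
    show "D' = D"
    proof
      fix e show "D' e = D e"
        by (rule env_ext[of scal]) (use D D' in auto)
    qed
  qed (use D in auto)
  with D show "lin scal scal (phi f)" "phi f (tens a b) = tens (f a) b + tens a (f b)" by auto
qed

lemma phi_Der:
  assumes "f \<in> Der"
  shows "phi f \<in> Der"
proof -
  note lin = lin_phi[OF assms]
  have *: "phi f (tens a b * tens a' b') = phi f (tens a b) * tens a' b' + tens a b * phi f (tens a' b')"
    for a b a' b'
    by (simp add: tens_mult phi_tens[OF assms] Der_mult[OF assms] distrib_left distrib_right
      tens_add_left tens_add_right)
  have *: "phi f (tens a b * e') = phi f (tens a b) * e' + tens a b * phi f e'" for a b e'
    by (rule env_ext[where s = scal and f = "\<lambda>e'. phi f (tens a b * e')" and g = "\<lambda>e'. phi f (tens a b) * e' + tens a b * phi f e'"])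
      (intro lin_plus lin_mult_left lin_comp[OF lin_mult_left lin] lin_comp[OF lin lin_mult_left] *)+
  have "phi f (e * e') = phi f e * e' + e * phi f e'" for e e'
    by (rule env_ext[where s = scal and f = "\<lambda>e. phi f (e * e')" and g = "\<lambda>e. phi f e * e' + e * phi f e'"])
      (intro lin_plus lin_mult_right lin_comp[OF lin_mult_right lin] lin_comp[OF lin lin_mult_right] *)+
  with lin show ?thesis by (simp add: Der_def)
qed

lemma contraction:
  assumes "f \<in> Der"
  shows lin_contraction: "lin scale_omega scal (contraction f)"
    and contraction_elt: "contraction f (elt a b c) = a * f b * c"
proof -
  note f = lin_add[OF Der_lin[OF assms]] lin_scale[OF Der_lin[OF assms]] Der_mult[OF assms]
  obtain i where i: "lin scale_omega scal i" "\<And>a b c. i (elt a b c) = a * f b * c"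
    by (rule free.omega_lift[of "\<lambda>a b c. a * f b * c"])
      (auto simp: f algebra_simps scal_mult_left scal_mult_right)
  have "contraction f = i"
    unfolding contraction_def
  proof (rule the_equality, intro conjI allI)
    show "lin scale_omega scal i" by (rule i)
    show "i (lmul x m) = x * i m" for x m
      by (rule omega_ext[OF lin_comp[OF lin_lmul i(1)] lin_comp[OF i(1) lin_mult_left]])
        (simp add: lmul_elt i mult.assoc)
    show "i (rmul m x) = i m * x" for x m
      by (rule omega_ext[OF lin_comp[OF lin_rmul i(1)] lin_comp[OF i(1) lin_mult_right]])
        (simp add: rmul_elt i mult.assoc)
    show "i (d b) = f b" for b by (simp add: d_elt i)
    fix j assume j: "lin scale_omega scal j \<and> (\<forall>x m. j (lmul x m) = x * j m)
      \<and> (\<forall>x m. j (rmul m x) = j m * x) \<and> (\<forall>b. j (d b) = f b)"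
    show "j = i"
    proof
      fix m show "j m = i m"
        by (rule omega_ext[of scal]) (use i j in \<open>auto simp: elt_alt[of _ _ _] mult.assoc\<close>)
    qed
  qed
  with i show "lin scale_omega scal (contraction f)" "contraction f (elt a b c) = a * f b * c" by auto
qed

lemma lie_derivative:
  fixes f :: "('m::monoid_add \<Rightarrow>\<^sub>0 'k::field) \<Rightarrow> ('m \<Rightarrow>\<^sub>0 'k)"
  assumes "f \<in> Der"
  shows lin_lie_derivative: "lin scale_omega scale_omega (lie_derivative f)"
    and lie_derivative_elt: "lie_derivative f (elt a b c) = elt (f a) b c + elt a (f b) c + elt a b (f c)"
proof -
  note f = lin_add[OF Der_lin[OF assms]] lin_scale[OF Der_lin[OF assms]] Der_mult[OF assms]
  note elts = elt_add_left elt_add_mid elt_add_right elt_scal_left elt_scal_mid elt_scal_right elt_leibniz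
  obtain L where L: "lin scale_omega scale_omega L"
      "\<And>a b c. L (elt a b c) = elt (f a) b c + elt a (f b) c + elt a b (f c)"
    by (rule omega.omega_lift[of "\<lambda>a b c. elt (f a) b c + elt a (f b) c + elt a b (f c)"])
      (simp_all add: f elts omega.scale_right_distrib algebra_simps)
  have "lie_derivative f = L"
    unfolding lie_derivative_def
  proof (rule the_equality, intro conjI allI)
    show "lin scale_omega scale_omega L" by (rule L)
    show "L (lmul b (d b')) = lmul (f b) (d b') + lmul b (d (f b'))" for b b'
      by (simp add: d_elt lmul_elt L Der_one[OF assms] lin_zero[OF lin_elt_right])
    fix L' assume L': "lin scale_omega scale_omega L'
      \<and> (\<forall>b b'. L' (lmul b (d b')) = lmul (f b) (d b') + lmul b (d (f b')))"
    show "L' = L"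
    proof
      fix m show "L' m = L m"
      proof (rule omega_ext[where s = scale_omega and f = L' and g = L])
        have *: "L' (elt a b 1) = L (elt a b 1)" for a b
          using L'[THEN conjunct2, rule_format, of a b]
          by (simp add: d_elt lmul_elt L Der_one[OF assms] lin_zero[OF lin_elt_right])
        fix a b c :: "'m \<Rightarrow>\<^sub>0 'k"
        \<comment> \<open>The right factor is moved into the differential: \<open>a (db) c = a d(bc) - ab dc\<close>.\<close>
        have "elt a b c = elt a (b * c) 1 - elt (a * b) c 1"
          using elt_leibniz[of a b c 1] by simp
        then show "L' (elt a b c) = L (elt a b c)"
          using * L' by (simp add: lin_diff[OF L(1)] lin_diff[OF L'[THEN conjunct1]])
      qed (use L L' in auto)
    qed
  qed (* *)
  with L show "lin scale_omega scale_omega (lie_derivative f)"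
    "lie_derivative f (elt a b c) = elt (f a) b c + elt a (f b) c + elt a b (f c)" by auto
qed

text \<open>
  The Lie derivative is not a module map; its defect is the action of \<open>phi f\<close> on the coefficients,
  which is also the defect of the contracted connection.
\<close>

lemma lie_derivative_env_act:
  assumes "f \<in> Der"
  shows "lie_derivative f (env_act e m) = env_act (phi f e) m + env_act e (lie_derivative f m)"
proof (rule env_ext[where s = scale_omega and f = "\<lambda>e. lie_derivative f (env_act e m)"
      and g = "\<lambda>e. env_act (phi f e) m + env_act e (lie_derivative f m)"])
  note lin = lin_lie_derivative[OF assms]
  fix a b
  show "lie_derivative f (env_act (tens a b) m)
    = env_act (phi f (tens a b)) m + env_act (tens a b) (lie_derivative f m)"
    by (rule omega_ext[OF lin_comp[OF lin_env_act_right lin]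
        lin_plus[OF lin_env_act_right lin_comp[OF lin lin_env_act_right]]])
      (simp add: env_act_elt lie_derivative_elt[OF assms] phi_tens[OF assms] lin_add[OF lin_env_act_right]
        lin_add[OF lin_env_act_left] Der_mult[OF assms] elt_add_left elt_add_right)
qed (intro lin_plus lin_comp[OF lin_env_act_left lin_lie_derivative[OF assms]]
    lin_comp[OF lin_phi[OF assms] lin_env_act_left] lin_env_act_left)+

section \<open>The 1-forms of the tensor algebra are free\<close>

abbreviation letter :: "'n \<Rightarrow> ('n, 'k::field) talg" where
  "letter i \<equiv> gen (Word [i])"

lemma gen_times: "gen u * gen v = gen (u + v)" for u v :: "'m::monoid_add"
  by (simp add: mult_single)

lemma gen_Cons: "gen (Word (l # w)) = letter l * (gen (Word w) :: ('n, 'k::field) talg)"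
  by (simp add: gen_times plus_fmon_def)

lemma gen_Nil: "gen (Word []) = (1 :: ('n, 'k::field) talg)"
  by (simp add: single_one flip: zero_fmon_def)

lemma talg_ext:
  assumes "lin scal s f" "lin scal s g" "\<And>w. f (gen (Word w)) = g (gen (Word w))"
  shows "f a = g a"
  by (rule free_ext[OF assms(1,2)]) (metis assms(3) fmon.exhaust)

text \<open>
  The double derivation (noncommutative partial derivative) at the letter \<open>j\<close>: a word goes to the
  sum, over the occurrences of \<open>j\<close>, of the part before \<open>\<otimes>\<close> the part after.
\<close>

fun fox_word :: "'n \<Rightarrow> 'n list \<Rightarrow> ('n fmon, 'k::field) env" where
  "fox_word j [] = 0"
| "fox_word j (l # w) = (if l = j then tens 1 (gen (Word w)) else 0) + tens (letter l) 1 * fox_word j w"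

definition fox :: "'n \<Rightarrow> ('n, 'k::field) talg \<Rightarrow> ('n fmon, 'k) env" where
  "fox j = lext scal (\<lambda>u. fox_word j (letters u))"

lemma lin_fox: "lin scal scal (fox j)"
  unfolding fox_def by (rule free.linear_lext)

lemma fox_gen [simp]: "fox j (gen (Word w)) = fox_word j w"
  by (simp add: fox_def)

lemma fox_word_append:
  "fox_word j (u @ v) = tens 1 (gen (Word v)) * fox_word j u + tens (gen (Word u)) 1 * fox_word j v"
proof (induction u)
  case Nil
  then show ?case by (simp add: gen_Nil flip: one_env)
next
  case (Cons l u)
  have *: "tens 1 (gen (Word v)) * tens (letter l) 1 = tens (letter l) 1 * (tens 1 (gen (Word v)) :: ('a fmon, 'b) env)"
    by (simp add: tens_mult)
  have "gen (Word (u @ v)) = (gen (Word u) * gen (Word v) :: ('a, 'b) talg)"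
    by (simp add: gen_times plus_fmon_def)
  with Cons show ?case
    by (simp add: distrib_left tens_mult gen_Cons[of l u] * flip: mult.assoc)
qed

lemma fox_mult: "fox j (a * b) = tens 1 b * fox j a + tens a 1 * fox j b"
proof -
  have *: "fox j (gen (Word u) * gen (Word v))
      = tens 1 (gen (Word v)) * fox j (gen (Word u)) + tens (gen (Word u)) 1 * fox j (gen (Word v))" for u v
    by (simp add: gen_times plus_fmon_def fox_word_append)
  have *: "fox j (gen (Word u) * b) = tens 1 b * fox j (gen (Word u)) + tens (gen (Word u)) 1 * fox j b" for u b
    by (rule talg_ext[where s = scal and f = "\<lambda>b. fox j (gen (Word u) * b)"
          and g = "\<lambda>b. tens 1 b * fox j (gen (Word u)) + tens (gen (Word u)) 1 * fox j b"])
      (intro lin_plus lin_comp[OF lin_mult_left lin_fox] lin_comp[OF lin_tens_right lin_mult_right]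
        lin_comp[OF lin_fox lin_mult_left] *)+
  show ?thesis
    by (rule talg_ext[where s = scal and f = "\<lambda>a. fox j (a * b)"
          and g = "\<lambda>a. tens 1 b * fox j a + tens a 1 * fox j b"])
      (intro lin_plus lin_comp[OF lin_mult_right lin_fox] lin_comp[OF lin_tens_left lin_mult_right]
        lin_comp[OF lin_fox lin_mult_left] *)+
qed

text \<open>
  By \<open>fox_mult\<close> the map \<open>fox j\<close> is a derivation for the outer bimodule structure of the enveloping
  algebra, so it factors through the 1-forms. The resulting module maps form the basis dual to the
  forms \<open>d (letter j)\<close>; the choice operator only picks the factorisation, which is unique.
\<close>

definition coord :: "'n \<Rightarrow> ('n fmon, 'k::field) omega \<Rightarrow> ('n fmon, 'k) env" where
  "coord j = (SOME g. lin scale_omega scal g \<and> (\<forall>a b c. g (elt a b c) = tens a c * fox j b))"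

lemma coord:
  shows lin_coord: "lin scale_omega scal (coord j :: ('n fmon, 'k::field) omega \<Rightarrow> _)"
    and coord_elt: "coord j (elt a b c) = tens a c * fox j (b :: ('n, 'k) talg)"
proof -
  obtain g :: "('n fmon, 'k) omega \<Rightarrow> ('n fmon, 'k) env"
    where "lin scale_omega scal g" "\<And>a b c. g (elt a b c) = tens a c * fox j b"
  proof (rule free.omega_lift[of "\<lambda>a b c. tens a c * fox j b"])
    fix a b b' c :: "('n, 'k) talg"
    show "tens a c * fox j (b * b') = tens a (b' * c) * fox j b + tens (a * b) c * fox j b'"
      by (simp add: fox_mult distrib_left tens_mult flip: mult.assoc)
  qed (simp_all add: tens_add_left tens_add_right distrib_left distrib_right tens_scal_left tens_scal_right
      scal_mult_left scal_mult_right lin_add[OF lin_fox] lin_scale[OF lin_fox])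
  then have "\<exists>g. lin scale_omega scal g \<and> (\<forall>a b c. g (elt a b c) = tens a c * fox j (b :: ('n, 'k) talg))"
    by blast
  from someI_ex[OF this]
  show "lin scale_omega scal (coord j :: ('n fmon, 'k) omega \<Rightarrow> _)"
    "coord j (elt a b c) = tens a c * fox j (b :: ('n, 'k) talg)"
    unfolding coord_def by auto
qed

lemma coord_d: "coord j (d b) = fox j b"
  by (simp add: d_elt coord_elt flip: one_env)

lemma coord_env_act: "coord j (env_act e m) = e * coord j m"
proof (rule env_ext[where s = scal and f = "\<lambda>e. coord j (env_act e m)" and g = "\<lambda>e. e * coord j m"])
  fix a b
  show "coord j (env_act (tens a b) m) = tens a b * coord j m"
    by (rule omega_ext[OF lin_comp[OF lin_env_act_right lin_coord] lin_comp[OF lin_coord lin_mult_left]])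
      (simp add: env_act_elt coord_elt tens_mult flip: mult.assoc)
qed (intro lin_comp[OF lin_env_act_left lin_coord] lin_mult_right)+

lemma coord_dual: "coord j \<in> dual_omega"
  by (simp add: dual_omega_def lin_coord coord_env_act)

lemma coord_letter: "coord j (d (letter i)) = (if i = j then 1 else 0)"
  by (simp add: coord_d gen_Nil flip: one_env)

text \<open>
  The forms \<open>d (letter j)\<close> generate because the Leibniz rule expands \<open>d\<close> of a word letter by letter;
  together with \<open>coord_letter\<close> this makes them a basis of the left module.
\<close>

lemma omega_expand: "m = (\<Sum>j\<in>UNIV. env_act (coord j m) (d (letter j)))"
  for m :: "('n::finite fmon, 'k::field) omega"
proof -
  have word: "d (gen (Word w) :: ('n, 'k) talg) = (\<Sum>j\<in>UNIV. env_act (fox j (gen (Word w))) (d (letter j)))"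
    for w :: "'n list"
  proof (induction w)
    case Nil
    show ?case
      unfolding fox_gen by (simp add: gen_Nil d_one lin_zero[OF lin_env_act_left])
  next
    case (Cons l w)
    have "(\<Sum>j\<in>UNIV. env_act (fox j (gen (Word (l # w)) :: ('n, 'k) talg)) (d (letter j)))
      = (\<Sum>j\<in>UNIV. (if l = j then env_act (tens 1 (gen (Word w))) (d (letter j)) else 0)
          + env_act (tens (letter l) 1) (env_act (fox j (gen (Word w))) (d (letter j))))"
      by (intro sum.cong refl)
        (auto simp: lin_add[OF lin_env_act_left] env_act_mult lin_zero[OF lin_env_act_left])
    also have "\<dots> = env_act (tens 1 (gen (Word w))) (d (letter l)) + env_act (tens (letter l) 1) (d (gen (Word w)))"
      unfolding sum.distrib lin_sum[OF lin_env_act_right, symmetric] Cons.IH[symmetric] by simp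
    also have "\<dots> = d (gen (Word (l # w)))"
      by (simp add: gen_Cons[of l w] d_elt env_act_elt elt_leibniz[of 1 "letter l" "gen (Word w)" 1])
    finally show ?case by simp
  qed
  have d: "d b = (\<Sum>j\<in>UNIV. env_act (fox j b) (d (letter j)))" for b :: "('n, 'k) talg"
    by (rule talg_ext[where s = scale_omega and f = d and g = "\<lambda>b. \<Sum>j\<in>UNIV. env_act (fox j b) (d (letter j))"])
      (intro lin_d lin_setsum free.vector_space_axioms omega.vector_space_axioms
        lin_comp[OF lin_fox lin_env_act_left] word)+
  show ?thesis
  proof (rule omega_ext[where s = scale_omega and f = "\<lambda>m. m" and g = "\<lambda>m. \<Sum>j\<in>UNIV. env_act (coord j m) (d (letter j))"])
    fix a b c :: "('n, 'k) talg"
    show "elt a b c = (\<Sum>j\<in>UNIV. env_act (coord j (elt a b c)) (d (letter j)))"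
      unfolding coord_elt env_act_mult lin_sum[OF lin_env_act_right, symmetric] d[symmetric]
      by (rule elt_env_act)
  qed (auto intro!: lin_setsum omega.vector_space_axioms lin_comp[OF lin_coord lin_env_act_left]
      simp: Vector_Spaces.linear_iff[of _ _ "\<lambda>m. m"])
qed

section \<open>The connection and the Jacobian\<close>

lemma otimes_add_left: "otimes (w + w') m = otimes w m + otimes w' m"
  and otimes_add_right: "otimes w (m + m') = otimes w m + otimes w m'"
  and otimes_scale: "otimes (scale_omega r w) m = scale_omega_tens r (otimes w m)"
  and otimes_balanced: "otimes (rmul w e) m = otimes w (env_act e m)"
  unfolding otimes_def plus_omega_tens.abs_eq scale_omega_tens.abs_eq omega_tens.abs_eq_iff modrel_def
  by (rule free.span_base, simp add: diff_diff_eq[symmetric] omega_tens_rels.intros)+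

lemma lin_otimes: "lin scale_omega scale_omega_tens (\<lambda>w. otimes w m)"
  by (simp add: Vector_Spaces.linear_iff omega.vector_space_axioms omega_tens.vector_space_axioms
    otimes_add_left otimes_scale)

lemma otimes_sum: "otimes w (\<Sum>i\<in>A. g i) = (\<Sum>i\<in>A. otimes w (g i))"
proof -
  have "otimes w 0 = 0" using otimes_add_right[of w 0 0] by simp
  then show ?thesis by (induction A rule: infinite_finite_induct) (auto simp: otimes_add_right)
qed

lemma omega_tens_ext:
  assumes "lin scale_omega_tens s f" "lin scale_omega_tens s g" "\<And>w m. f (otimes w m) = g (otimes w m)"
  shows "f t = g t"
  by (rule quotient_ext[OF Quotient3_omega_tens plus_omega_tens.abs_eq scale_omega_tens.abs_eq assms(1,2)])
    (metis assms(3) otimes_def surj_pair)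

lemma (in vector_space) omega_tens_lift:
  fixes h :: "('m::monoid_add \<times> 'm opp, 'a) omega \<Rightarrow> ('m, 'a) omega \<Rightarrow> 'b"
  assumes "\<And>w w' m. h (w + w') m = h w m + h w' m"
    "\<And>w m m'. h w (m + m') = h w m + h w m'"
    "\<And>r w m. h (scale_omega r w) m = scale r (h w m)"
    "\<And>w e m. h (rmul w e) m = h w (env_act e m)"
  obtains g where "lin scale_omega_tens scale g" "\<And>w m. g (otimes w m) = h w m"
proof -
  have zero: "lext scale (\<lambda>(w, m). h w m) x = 0" if "x \<in> omega_tens_rels" for x
    using that
    by cases (simp_all add: lin_diff[OF linear_lext] lin_scale[OF linear_lext] assms)
  note lift = quotient_lift[OF Quotient3_omega_tens _ plus_omega_tens.abs_eq scale_omega_tens.abs_eq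
      omega_tens.vector_space_axioms]
  show ?thesis
  proof (rule that)
    show "lin scale_omega_tens scale (\<lambda>t. lext scale (\<lambda>(w, m). h w m) (rep_omega_tens t))"
      by (rule lift(1)) (rule zero)
    show "lext scale (\<lambda>(w, m). h w m) (rep_omega_tens (otimes w m)) = h w m" for w m
      unfolding otimes_def by (subst lift(2)) (simp_all add: zero)
  qed
qed

lemma lmul_tens_otimes: "lmul_tens b (otimes w m) = otimes (lmul b w) m"
  by (simp add: otimes_def lmul_tens.abs_eq)

lemma lin_lmul_tens: "lin scale_omega_tens scale_omega_tens (lmul_tens b)"
proof -
  have "lmul_tens b (t + t') = lmul_tens b t + lmul_tens b t'"
    "lmul_tens b (scale_omega_tens r t) = scale_omega_tens r (lmul_tens b t)" for t t' r
    by (induct t, induct t', simp add: plus_omega_tens.abs_eq lmul_tens.abs_eq)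
      (induct t, simp add: scale_omega_tens.abs_eq lmul_tens.abs_eq)
  then show ?thesis by (simp add: Vector_Spaces.linear_iff omega_tens.vector_space_axioms)
qed

lemma incl_axis: "incl (axis j 1) = letter j"
  by (simp add: incl_def axis_def if_distrib cong: if_cong)

text \<open>
  In coordinates the connection differentiates the coefficients: it sends \<open>\<Sum>j. e\<^sub>j (d j)\<close> to
  \<open>\<Sum>j. (d e\<^sub>j) \<otimes> (d j)\<close>, and the Leibniz rule leaves no other choice once the basis goes to 0.
\<close>

lemma nabla:
  shows lin_nabla: "lin scale_omega scale_omega_tens (nabla :: ('n::finite fmon, 'k::field) omega \<Rightarrow> _)"
    and nabla_env_act: "nabla (env_act b m) = otimes (d b) (m :: ('n fmon, 'k) omega) + lmul_tens b (nabla m)"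
    and nabla_letter: "nabla (d (letter j) :: ('n fmon, 'k) omega) = 0"
proof -
  define N :: "('n fmon, 'k) omega \<Rightarrow> _" where "N m = (\<Sum>j\<in>UNIV. otimes (d (coord j m)) (d (letter j)))" for m
  have lin: "lin scale_omega scale_omega_tens N"
    unfolding N_def
    by (intro lin_setsum omega.vector_space_axioms omega_tens.vector_space_axioms
        lin_comp[OF lin_comp[OF lin_coord lin_d] lin_otimes])
  have N: "N (env_act b m) = otimes (d b) m + lmul_tens b (N m)" for b m
  proof -
    have "N (env_act b m) = (\<Sum>j\<in>UNIV. otimes (d b) (env_act (coord j m) (d (letter j))))
      + (\<Sum>j\<in>UNIV. lmul_tens b (otimes (d (coord j m)) (d (letter j))))"
      by (simp add: N_def coord_env_act d_mult otimes_add_left otimes_balanced lmul_tens_otimes sum.distrib)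
    also have "(\<Sum>j\<in>UNIV. otimes (d b) (env_act (coord j m) (d (letter j))))
      = otimes (d b) (\<Sum>j\<in>UNIV. env_act (coord j m) (d (letter j)))"
      by (rule otimes_sum[symmetric])
    finally show ?thesis
      by (simp add: N_def lin_sum[OF lin_lmul_tens] flip: omega_expand)
  qed
  have N_letter: "N (d (letter j)) = 0" for j
    by (auto simp: N_def coord_letter d_one lin_zero[OF lin_d] lin_zero[OF lin_otimes] intro!: sum.neutral)
  have "nabla = N"
    unfolding nabla_def
  proof (rule the_equality, intro conjI allI)
    show "lin scale_omega scale_omega_tens N" by (rule lin)
    show "N (env_act b m) = otimes (d b) m + lmul_tens b (N m)" for b m by (rule N)
    show "N (d (incl w)) = 0" for w :: "'k ^ 'n"
    proof -
      have "Poly_Mapping.single (Word [i]) (w $ i) = scal (w $ i) (letter i)" for i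
        by (simp only: scal_gen)
      then show ?thesis
        by (simp add: incl_def lin_sum[OF lin_d] lin_sum[OF lin] lin_scale[OF lin_d] lin_scale[OF lin] N_letter)
    qed
    fix N' assume N': "lin scale_omega scale_omega_tens N'
      \<and> (\<forall>b m. N' (env_act b m) = otimes (d b) m + lmul_tens b (N' m)) \<and> (\<forall>w :: 'k ^ 'n. N' (d (incl w)) = 0)"
    have N'_letter: "N' (d (letter j)) = 0" for j
      using N' by (metis incl_axis)
    show "N' = N"
    proof
      fix m
      have "N' (\<Sum>j\<in>UNIV. env_act (coord j m) (d (letter j))) = N (\<Sum>j\<in>UNIV. env_act (coord j m) (d (letter j)))"
        using N' by (simp add: lin_sum[OF lin] lin_sum[OF N'[THEN conjunct1]] N N_letter N'_letter)
      then show "N' m = N m" by (simp flip: omega_expand)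
    qed
  qed
  with lin N N_letter show "lin scale_omega scale_omega_tens (nabla :: ('n fmon, 'k) omega \<Rightarrow> _)"
    "nabla (env_act b m) = otimes (d b) (m :: ('n fmon, 'k) omega) + lmul_tens b (nabla m)"
    "nabla (d (letter j) :: ('n fmon, 'k) omega) = 0" by auto
qed

lemma tens_id:
  assumes i: "lin scale_omega scal i" "\<And>w e. i (rmul w e) = i w * e"
  shows lin_tens_id: "lin scale_omega_tens scale_omega (tens_id i)"
    and tens_id_otimes: "tens_id i (otimes w m) = env_act (i w) m"
proof -
  obtain g where g: "lin scale_omega_tens scale_omega g" "\<And>w m. g (otimes w m) = env_act (i w) m"
    by (rule omega.omega_tens_lift[of "\<lambda>w m. env_act (i w) m"])
      (auto simp: lin_add[OF i(1)] lin_scale[OF i(1)] i(2) lin_add[OF lin_env_act_left]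
        lin_scale[OF lin_env_act_left] lin_add[OF lin_env_act_right] env_act_mult)
  have "tens_id i = g"
    unfolding tens_id_def
  proof (rule the_equality)
    fix g' assume g': "lin scale_omega_tens scale_omega g' \<and> (\<forall>w m. g' (otimes w m) = env_act (i w) m)"
    show "g' = g"
    proof
      fix t show "g' t = g t"
        by (rule omega_tens_ext[of scale_omega]) (use g g' in auto)
    qed
  qed (use g in auto)
  with g show "lin scale_omega_tens scale_omega (tens_id i)" "tens_id i (otimes w m) = env_act (i w) m" by auto
qed

text \<open>
  The cochain \<open>c_nabla\<close> has values in module endomorphisms because the inhomogeneous terms of the
  connection and of the Lie derivative cancel; as the connection kills the basis, its matrix is
  minus the noncommutative Jacobian matrix of the derivation.
\<close>

lemma c_nabla:
  fixes f :: "('n::finite, 'k::field) talg \<Rightarrow> ('n, 'k) talg"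
  assumes f: "f \<in> Der"
  shows lin_c_nabla: "lin scale_omega scale_omega (c_nabla f)"
    and c_nabla_env_act: "c_nabla f (env_act e m) = env_act e (c_nabla f m)"
    and c_nabla_letter: "c_nabla f (d (letter j)) = - d (f (letter j))"
proof -
  let ?i = "contraction (phi f)"
  have i: "lin scale_omega scal ?i" "?i (rmul w e) = ?i w * e" "?i (lmul e w) = e * ?i w" "?i (d e) = phi f e" for w e
  proof -
    show lin: "lin scale_omega scal ?i" by (rule lin_contraction[OF phi_Der[OF f]])
    show "?i (rmul w e) = ?i w * e"
      by (rule omega_ext[OF lin_comp[OF lin_rmul lin] lin_comp[OF lin lin_mult_right]])
        (simp add: rmul_elt contraction_elt[OF phi_Der[OF f]] mult.assoc)
    show "?i (lmul e w) = e * ?i w"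
      by (rule omega_ext[OF lin_comp[OF lin_lmul lin] lin_comp[OF lin lin_mult_left]])
        (simp add: lmul_elt contraction_elt[OF phi_Der[OF f]] mult.assoc)
    show "?i (d e) = phi f e" by (simp add: d_elt contraction_elt[OF phi_Der[OF f]])
  qed
  note ti = lin_tens_id[OF i(1,2)] tens_id_otimes[OF i(1,2)]
  have tl: "tens_id ?i (lmul_tens e t) = env_act e (tens_id ?i t)" for e t
    by (rule omega_tens_ext[OF lin_comp[OF lin_lmul_tens ti(1)] lin_comp[OF ti(1) lin_env_act_right]])
      (simp add: lmul_tens_otimes ti(2) i(3) env_act_mult)
  show "lin scale_omega scale_omega (c_nabla f)"
    unfolding c_nabla_def
    by (intro lin_minus lin_comp[OF lin_nabla ti(1)] lin_lie_derivative[OF f])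
  show "c_nabla f (env_act e m) = env_act e (c_nabla f m)"
    by (simp add: c_nabla_def nabla_env_act lin_add[OF ti(1)] ti(2) i(4) tl lie_derivative_env_act[OF f]
      lin_diff[OF lin_env_act_right])
  show "c_nabla f (d (letter j)) = - d (f (letter j))"
    unfolding c_nabla_def nabla_letter lin_zero[OF ti(1)]
    by (simp add: d_elt lie_derivative_elt[OF f] Der_one[OF f]
      lin_zero[OF lin_elt_left] lin_zero[OF lin_elt_right])
qed

section \<open>The trace\<close>

lemma cyc_commute: "cyc (a * b) = cyc (b * a)"
  by (auto simp: cyc.abs_eq_iff modrel_def intro!: free.span_base)

lemma lin_cyc: "lin scal scale_cyc cyc"
  by (simp add: Vector_Spaces.linear_iff free.vector_space_axioms cyc.vector_space_axioms
    plus_cyc.abs_eq scale_cyc.abs_eq)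

text \<open>
  Expanding \<open>m\<close> in the basis turns \<open>|\<mu>(m)|\<close> into \<open>\<Sum>j. |coord j m * \<mu>(d j)|\<close>, and exchanging the two
  factors under the bars turns the sum over any presentation of \<open>\<Phi>\<close> into the sum of the diagonal
  entries of \<open>\<Phi>\<close>. So the trace does not depend on the presentation.
\<close>

lemma Tr_coord:
  fixes \<Phi> :: "('n::finite fmon, 'k::field) omega \<Rightarrow> ('n fmon, 'k) omega"
  assumes "lin scale_omega scale_omega \<Phi>" "\<And>e m. \<Phi> (env_act e m) = env_act e (\<Phi> m)"
  shows "Tr \<Phi> = (\<Sum>j\<in>UNIV. cyc (coord j (\<Phi> (d (letter j)))))"
  unfolding Tr_def
proof (rule the_equality)
  obtain js :: "'n list" where js: "set js = UNIV" "distinct js"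
    using finite_distinct_list[of "UNIV :: 'n set"] by auto
  let ?ps = "map (\<lambda>j. (coord j :: ('n fmon, 'k) omega \<Rightarrow> _, \<Phi> (d (letter j)))) js"
  have "\<Phi> x = (\<Sum>(\<mu>, m)\<leftarrow>?ps. env_act (\<mu> x) m)" for x
  proof -
    have "\<Phi> x = \<Phi> (\<Sum>j\<in>UNIV. env_act (coord j x) (d (letter j)))" by (simp flip: omega_expand)
    also have "\<dots> = (\<Sum>j\<in>UNIV. env_act (coord j x) (\<Phi> (d (letter j))))"
      by (simp add: lin_sum[OF assms(1)] assms(2))
    finally show ?thesis using js by (simp add: o_def sum_list_distinct_conv_sum_set)
  qed
  moreover have "(\<Sum>j\<in>UNIV. cyc (coord j (\<Phi> (d (letter j))))) = (\<Sum>(\<mu>, m)\<leftarrow>?ps. cyc (\<mu> m))"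
    using js by (simp add: o_def sum_list_distinct_conv_sum_set)
  moreover have "\<forall>(\<mu>, m)\<in>set ?ps. \<mu> \<in> dual_omega" by (auto simp: coord_dual)
  ultimately show "\<exists>ps. (\<forall>(\<mu>, m)\<in>set ps. \<mu> \<in> dual_omega) \<and> (\<forall>x. \<Phi> x = (\<Sum>(\<mu>, m)\<leftarrow>ps. env_act (\<mu> x) m))
     \<and> (\<Sum>j\<in>UNIV. cyc (coord j (\<Phi> (d (letter j))))) = (\<Sum>(\<mu>, m)\<leftarrow>ps. cyc (\<mu> m))"
    by blast
next
  fix t assume "\<exists>ps. (\<forall>(\<mu>, m)\<in>set ps. \<mu> \<in> dual_omega) \<and> (\<forall>x. \<Phi> x = (\<Sum>(\<mu>, m)\<leftarrow>ps. env_act (\<mu> x) m))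
     \<and> t = (\<Sum>(\<mu>, m)\<leftarrow>ps. cyc (\<mu> m))"
  then obtain ps where dual: "\<And>\<mu> m. (\<mu>, m) \<in> set ps \<Longrightarrow> \<mu> \<in> dual_omega"
    and \<Phi>: "\<And>x. \<Phi> x = (\<Sum>(\<mu>, m)\<leftarrow>ps. env_act (\<mu> x) m)" and t: "t = (\<Sum>(\<mu>, m)\<leftarrow>ps. cyc (\<mu> m))"
    by blast
  have "cyc (\<mu> m) = (\<Sum>j\<in>UNIV. cyc (coord j (env_act (\<mu> (d (letter j))) m)))" if "(\<mu>, m) \<in> set ps" for \<mu> m
  proof -
    have \<mu>: "lin scale_omega scal \<mu>" "\<And>e m. \<mu> (env_act e m) = e * \<mu> m"
      using dual[OF that] by (auto simp: dual_omega_def)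
    have "\<mu> m = \<mu> (\<Sum>j\<in>UNIV. env_act (coord j m) (d (letter j)))" by (simp flip: omega_expand)
    also have "\<dots> = (\<Sum>j\<in>UNIV. coord j m * \<mu> (d (letter j)))" by (simp add: lin_sum[OF \<mu>(1)] \<mu>(2))
    finally have "cyc (\<mu> m) = (\<Sum>j\<in>UNIV. cyc (coord j m * \<mu> (d (letter j))))"
      by (simp add: lin_sum[OF lin_cyc])
    also have "\<dots> = (\<Sum>j\<in>UNIV. cyc (coord j (env_act (\<mu> (d (letter j))) m)))"
      by (simp add: coord_env_act cyc_commute[of "coord _ m"])
    finally show ?thesis .
  qed
  then have "t = (\<Sum>(\<mu>, m)\<leftarrow>ps. \<Sum>j\<in>UNIV. cyc (coord j (env_act (\<mu> (d (letter j))) m)))"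
    unfolding t by (intro arg_cong[where f = sum_list] map_cong) auto
  also have "\<dots> = (\<Sum>j\<in>UNIV. \<Sum>(\<mu>, m)\<leftarrow>ps. cyc (coord j (env_act (\<mu> (d (letter j))) m)))"
    by (induction ps) (auto simp: sum.distrib)
  also have "\<dots> = (\<Sum>j\<in>UNIV. cyc (coord j (\<Phi> (d (letter j)))))"
    unfolding \<Phi> lin_sum_list[OF lin_coord] lin_sum_list[OF lin_cyc]
    by (simp add: o_def case_prod_unfold)
  finally show "t = (\<Sum>j\<in>UNIV. cyc (coord j (\<Phi> (d (letter j)))))" .
qed

section \<open>An alternating functional on cyclic words\<close>

text \<open>
  The sign of \<open>L\<close>, read from right to left, as a permutation of \<open>0, \<dots>, k - 1\<close>, and 0 if \<open>L\<close> is not a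
  permutation. The list is reversed because a composition of module endomorphisms multiplies their
  coefficients in the opposite order.
\<close>

definition alt :: "nat \<Rightarrow> nat list \<Rightarrow> 'k::field_char_0" where
  "alt k L = (\<Sum>\<sigma> | \<sigma> permutes {..<k}. of_int (sign \<sigma>) * of_bool (rev (map \<sigma> [0..<k]) = L))"

lemma alt_length: "length L \<noteq> k \<Longrightarrow> alt k L = 0"
  by (auto simp: alt_def intro!: sum.neutral)

text \<open>
  Composing with the transposition of the two positions exchanges the terms that contribute to the
  two sides.
\<close>

lemma alt_swap: "(alt k (A @ a # b # B) :: 'k::field_char_0) = - alt k (A @ b # a # B)"
proof (cases "length (A @ a # b # B) = k")
  case False
  then show ?thesis by (simp add: alt_length)
next
  case True
  define c where "c = length B"
  define \<tau> where "\<tau> = Transposition.transpose c (Suc c)"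
  have k: "k = c + (2 + length A)" using True by (simp add: c_def)
  have \<tau>: "\<tau> permutes {..<k}" unfolding \<tau>_def by (rule permutes_swap_id) (simp_all add: k)
  have "[0..<k] = [0..<c] @ [c..<k]" using upt_add_eq_append[of 0 c "2 + length A"] k by simp
  moreover have "c < k" "Suc c < k" using k by simp_all
  ultimately have split: "[0..<k] = [0..<c] @ c # Suc c # [Suc (Suc c)..<k]"
    by (simp only: upt_conv_Cons)
  have "rev (map (\<sigma> \<circ> \<tau>) [0..<k]) = A @ a # b # B \<longleftrightarrow> rev (map \<sigma> [0..<k]) = A @ b # a # B"
    for \<sigma> :: "nat \<Rightarrow> nat"
  proof -
    define P Q where "P = map \<sigma> (rev [Suc (Suc c)..<k])" and "Q = map \<sigma> (rev [0..<c])"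
    have "rev (map (\<sigma> \<circ> \<tau>) [0..<k]) = P @ \<sigma> c # \<sigma> (Suc c) # Q"
      unfolding split P_def Q_def by (auto simp: \<tau>_def Transposition.transpose_def rev_map)
    moreover have "rev (map \<sigma> [0..<k]) = P @ \<sigma> (Suc c) # \<sigma> c # Q"
      unfolding split P_def Q_def by (simp add: rev_map)
    moreover have "length P = length A" by (simp add: P_def k del: upt_Suc)
    ultimately show ?thesis by auto
  qed
  note swap = this
  have "(alt k (A @ a # b # B) :: 'k)
    = (\<Sum>\<sigma> | \<sigma> permutes {..<k}. of_int (sign (\<sigma> \<circ> \<tau>)) * of_bool (rev (map (\<sigma> \<circ> \<tau>) [0..<k]) = A @ a # b # B))"
    unfolding alt_def by (rule sum_permutations_compose_right[OF \<tau>])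
  also have "\<dots> = (\<Sum>\<sigma> | \<sigma> permutes {..<k}. - (of_int (sign \<sigma>) * of_bool (rev (map \<sigma> [0..<k]) = A @ b # a # B)))"
  proof (rule sum.cong[OF refl])
    fix \<sigma> assume "\<sigma> \<in> {\<sigma>. \<sigma> permutes {..<k}}"
    then have "permutation \<sigma>" "permutation \<tau>"
      using \<tau> by (auto simp: permutation_permutes)
    then have "sign (\<sigma> \<circ> \<tau>) = - sign \<sigma>"
      by (simp add: sign_compose \<tau>_def sign_swap_id)
    then show "of_int (sign (\<sigma> \<circ> \<tau>)) * of_bool (rev (map (\<sigma> \<circ> \<tau>) [0..<k]) = A @ a # b # B)
      = - (of_int (sign \<sigma>) * of_bool (rev (map \<sigma> [0..<k]) = A @ b # a # B) :: 'k)"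
      by (simp add: swap)
  qed
  finally show ?thesis by (simp add: alt_def sum_negf)
qed

lemma alt_insert: "(alt k (A @ i # B) :: 'k::field_char_0) = (-1) ^ length A * alt k (i # A @ B)"
proof (induction A arbitrary: B rule: rev_induct)
  case (snoc a A)
  then show ?case by (simp add: alt_swap[of k A a i B])
qed simp

text \<open>
  A rotation of a list of odd length is an even permutation: this makes the sign a function of
  cyclic words.
\<close>

lemma alt_rotate:
  assumes "odd k"
  shows "(alt k (L @ [a]) :: 'k::field_char_0) = alt k (a # L)"
proof (cases "Suc (length L) = k")
  case True
  then have "even (length L)" using assms by auto
  then show ?thesis by (simp add: alt_insert[of k L a "[]"])
qed (simp add: alt_length)

text \<open>
  Moving the inserted entry by one place changes the sign, and the number of places is even. This
  will be the invariance of the functional under the derivations.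
\<close>

lemma alt_sum_insert:
  assumes "odd k"
  shows "(\<Sum>j<length L. alt k (take j L @ i # drop j L)) = (0 :: 'k::field_char_0)"
proof (cases "Suc (length L) = k")
  case True
  then have even: "even (length L)" using assms by auto
  have "(\<Sum>j<length L. alt k (take j L @ i # drop j L) :: 'k) = (\<Sum>j<length L. (-1) ^ j) * alt k (i # L)"
    unfolding sum_distrib_right by (intro sum.cong) (auto simp: alt_insert)
  also have "(\<Sum>j<2 * m. (-1) ^ j) = (0 :: 'k)" for m
    by (induction m) simp_all
  then have "(\<Sum>j<length L. (-1) ^ j) = (0 :: 'k)"
    using even by (auto elim!: evenE)
  finally show ?thesis by simp
qed (simp add: alt_length)

text \<open>For each \<open>s\<close> only \<open>\<sigma> = s\<close> contributes to \<open>alt\<close>, with the sign that \<open>s\<close> already carries.\<close>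

lemma sum_alt:
  "(\<Sum>s | s permutes {..<k}. of_int (sign s) * alt k (rev (map s [0..<k]))) = (of_nat (fact k) :: 'k::field_char_0)"
proof -
  have "of_int (sign s) * alt k (rev (map s [0..<k])) = (1 :: 'k)" if s: "s permutes {..<k}" for s
  proof -
    have "rev (map \<sigma> [0..<k]) = rev (map s [0..<k]) \<longleftrightarrow> \<sigma> = s" if "\<sigma> permutes {..<k}" for \<sigma>
    proof
      assume "rev (map \<sigma> [0..<k]) = rev (map s [0..<k])"
      then have "\<sigma> i = s i" if "i < k" for i using that by auto
      moreover have "\<sigma> i = s i" if "\<not> i < k" for i
        using that s \<open>\<sigma> permutes {..<k}\<close> by (simp add: permutes_def)
      ultimately show "\<sigma> = s" by blast
    qed auto
    then have "alt k (rev (map s [0..<k])) = (\<Sum>\<sigma> | \<sigma> permutes {..<k}. if \<sigma> = s then of_int (sign s) else (0 :: 'k))"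
      unfolding alt_def by (intro sum.cong refl) auto
    also have "\<dots> = of_int (sign s)"
      using s by (subst sum.delta) (auto intro: finite_permutations)
    finally show ?thesis by (simp flip: of_int_mult)
  qed
  then show ?thesis by (simp add: card_permutations)
qed

text \<open>
  A word is read as a sequence of letters \<open>x\<close> separated by gaps: \<open>exps x w\<close> is the number of
  letters before the first \<open>x\<close>, with the list of the lengths of the gaps after the occurrences of
  \<open>x\<close>. On a cyclic word the initial gap belongs to the last one.
\<close>

fun exps :: "'n \<Rightarrow> 'n list \<Rightarrow> nat \<times> nat list" where
  "exps x [] = (0, [])"
| "exps x (l # w) = (case exps x w of (b, as) \<Rightarrow> if l = x then (0, b # as) else (Suc b, as))"

fun close :: "nat \<times> nat list \<Rightarrow> nat list" where
  "close (b, as) = (if as = [] then [] else butlast as @ [last as + b])"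

definition cyc_alt :: "nat \<Rightarrow> 'n \<Rightarrow> 'n list \<Rightarrow> 'k::field_char_0" where
  "cyc_alt k x w = alt k (close (exps x w))"

lemma exps_snoc:
  "exps x (w @ [l]) = (case exps x w of (b, as) \<Rightarrow>
    if l = x then (b, as @ [0]) else if as = [] then (Suc b, []) else (b, butlast as @ [Suc (last as)]))"
  by (induction w) (auto split: prod.splits)

lemma exps_replicate: "y \<noteq> x \<or> i = 0 \<Longrightarrow> exps x (replicate i y @ w) = (i + fst (exps x w), snd (exps x w))"
  by (induction i) (auto split: prod.splits)

lemma exps_concat:
  "\<forall>a\<in>set N. y \<noteq> x \<or> a = 0 \<Longrightarrow> exps x (concat (map (\<lambda>a. x # replicate a y) N)) = (0, N)"
  by (induction N) (simp_all add: exps_replicate)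

lemma cyc_alt_rotate1:
  assumes "odd k"
  shows "(cyc_alt k x (w @ [l]) :: 'k::field_char_0) = cyc_alt k x (l # w)"
proof -
  obtain b as where w: "exps x w = (b, as)" by fastforce
  have "(alt k (as @ [b]) :: 'k) = alt k (b # as)" by (rule alt_rotate[OF assms])
  then show ?thesis
    by (cases as rule: rev_cases) (auto simp: cyc_alt_def exps_snoc w butlast_append)
qed

lemma cyc_alt_commute:
  assumes "odd k"
  shows "(cyc_alt k x (u @ v) :: 'k::field_char_0) = cyc_alt k x (v @ u)"
proof (induction u arbitrary: v)
  case (Cons l u)
  have "(cyc_alt k x ((l # u) @ v) :: 'k) = cyc_alt k x (u @ (v @ [l]))"
    by (simp add: cyc_alt_rotate1[OF assms, of x "u @ v" l, symmetric])
  also have "\<dots> = cyc_alt k x (v @ l # u)"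
    by (simp add: Cons.IH[of "v @ [l]"])
  finally show ?case .
qed simp

text \<open>The monomials in the image of a word under the derivation \<open>x \<mapsto> x y^i x\<close>.\<close>

fun ins :: "'n \<Rightarrow> 'n \<Rightarrow> nat \<Rightarrow> 'n list \<Rightarrow> 'n list list" where
  "ins x y i [] = []"
| "ins x y i (l # w) = (if l = x then [x # replicate i y @ x # w] else []) @ map ((#) l) (ins x y i w)"

text \<open>
  Replacing an occurrence of \<open>x\<close> by \<open>x y^i x\<close> inserts a gap of length \<open>i\<close> in front of the gap that
  follows it. For \<open>y = x\<close> this fails unless \<open>i = 0\<close>, since then the letters between the two new
  ones are themselves separators.
\<close>

lemma exps_ins:
  assumes "y \<noteq> x \<or> i = 0"
  shows "map (exps x) (ins x y i w) = (case exps x w of (b, as) \<Rightarrow>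
    map (\<lambda>j. (b, take j as @ i # drop j as)) [0..<length as])"
proof (induction w)
  case (Cons l w)
  obtain b as where w: "exps x w = (b, as)" by fastforce
  have "map (exps x) (map ((#) l) (ins x y i w))
    = map (\<lambda>(b, as). if l = x then (0, b # as) else (Suc b, as)) (map (exps x) (ins x y i w))"
    by (simp add: o_def)
  also have "\<dots> = map (\<lambda>j. if l = x then (0, b # take j as @ i # drop j as) else (Suc b, take j as @ i # drop j as)) [0..<length as]"
    unfolding Cons.IH by (simp add: w o_def)
  finally show ?case
    by (auto simp: w exps_replicate[OF assms] o_def upt_conv_Cons simp del: upt_Suc
      simp flip: map_Suc_upt)
qed simp

lemma sum_cyc_alt_ins:
  assumes "odd k" "y \<noteq> x \<or> i = 0"
  shows "(\<Sum>v\<leftarrow>ins x y i w. cyc_alt k x v) = (0 :: 'k::field_char_0)"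
proof -
  obtain b as where w: "exps x w = (b, as)" by fastforce
  have close: "close (b, take j as @ i # drop j as) = take j (close (b, as)) @ i # drop j (close (b, as))"
    if "j < length as" for j
    using that by (cases as rule: rev_cases) (auto simp: butlast_append)
  have len: "length (close (b, as)) = length as" by auto
  have "(\<Sum>v\<leftarrow>ins x y i w. cyc_alt k x v :: 'k) = (\<Sum>z\<leftarrow>map (exps x) (ins x y i w). alt k (close z))"
    by (simp add: cyc_alt_def o_def)
  also have "\<dots> = (\<Sum>j<length as. alt k (close (b, take j as @ i # drop j as)))"
    unfolding exps_ins[OF assms(2)] w
    by (simp add: o_def interv_sum_list_conv_sum_set_nat atLeast0LessThan del: close.simps)
  also have "\<dots> = (\<Sum>j<length (close (b, as)). alt k (take j (close (b, as)) @ i # drop j (close (b, as))))"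
    unfolding len by (intro sum.cong) (auto simp: close simp del: close.simps)
  also have "\<dots> = 0" by (rule alt_sum_insert[OF assms(1)])
  finally show ?thesis .
qed

section \<open>Commuting derivations with noncommuting Jacobians\<close>

fun der_word :: "('n \<Rightarrow> ('n, 'k::field) talg) \<Rightarrow> 'n list \<Rightarrow> ('n, 'k) talg" where
  "der_word h [] = 0"
| "der_word h (l # w) = h l * gen (Word w) + letter l * der_word h w"

definition der_of :: "('n \<Rightarrow> ('n, 'k::field) talg) \<Rightarrow> ('n, 'k) talg \<Rightarrow> ('n, 'k) talg" where
  "der_of h = lext scal (\<lambda>u. der_word h (letters u))"

lemma lin_der_of: "lin scal scal (der_of h)"
  unfolding der_of_def by (rule free.linear_lext)

lemma der_of_gen: "der_of h (gen (Word w)) = der_word h w"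
  by (simp add: der_of_def)

lemma der_of_letter: "der_of h (letter l) = h l"
  by (simp add: der_of_gen gen_Nil)

lemma gen_append: "gen (Word (u @ v)) = gen (Word u) * (gen (Word v) :: ('n, 'k::field) talg)"
  by (simp add: gen_times plus_fmon_def)

lemma der_of_Der: "der_of h \<in> Der"
proof -
  note lin = lin_der_of
  have append: "der_word h (u @ v) = der_word h u * gen (Word v) + gen (Word u) * der_word h v" for u v
  proof (induction u)
    case (Cons l u)
    then show ?case
      by (simp add: gen_append distrib_left distrib_right gen_Cons[of l u] mult.assoc)
  qed (simp add: gen_Nil)
  have *: "der_of h (gen (Word u) * gen (Word v))
      = der_of h (gen (Word u)) * gen (Word v) + gen (Word u) * der_of h (gen (Word v))" for u v
    by (simp add: der_of_gen append flip: gen_append)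
  have *: "der_of h (gen (Word u) * b) = der_of h (gen (Word u)) * b + gen (Word u) * der_of h b" for u b
    by (rule talg_ext[where s = scal and f = "\<lambda>b. der_of h (gen (Word u) * b)"
          and g = "\<lambda>b. der_of h (gen (Word u)) * b + gen (Word u) * der_of h b"])
      (intro lin_plus lin_mult_left lin_comp[OF lin_mult_left lin] lin_comp[OF lin lin_mult_left] *)+
  have "der_of h (a * b) = der_of h a * b + a * der_of h b" for a b
    by (rule talg_ext[where s = scal and f = "\<lambda>a. der_of h (a * b)"
          and g = "\<lambda>a. der_of h a * b + a * der_of h b"])
      (intro lin_plus lin_mult_right lin_comp[OF lin_mult_right lin] lin_comp[OF lin lin_mult_right] *)+
  then show ?thesis by (simp add: Der_def lin)
qed

lemma Der_eq_zero:
  fixes f :: "('n, 'k::field) talg \<Rightarrow> ('n, 'k) talg"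
  assumes f: "f \<in> Der" and letters: "\<And>l. f (letter l) = 0"
  shows "f a = 0"
proof (rule talg_ext[OF Der_lin[OF f]])
  show "lin scal scal (\<lambda>a :: ('n, 'k) talg. 0 :: ('n, 'k) talg)"
    by (intro lin_const_zero free.vector_space_axioms)
  show "f (gen (Word w)) = 0" for w
  proof (induction w)
    case (Cons l w)
    then show ?case by (simp add: gen_Cons[of l w] Der_mult[OF f] letters)
  qed (simp add: gen_Nil Der_one[OF f])
qed

lemma bracket_Der:
  assumes "f \<in> Der" "g \<in> Der"
  shows "bracket_der f g \<in> Der"
proof -
  have "lin scal scal (bracket_der f g)"
    unfolding bracket_der_def[abs_def]
    by (intro lin_minus lin_comp[OF Der_lin Der_lin] assms)
  then show ?thesis
    by (simp add: Der_def bracket_der_def Der_mult[OF assms(1)] Der_mult[OF assms(2)]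
      lin_add[OF Der_lin[OF assms(1)]] lin_add[OF Der_lin[OF assms(2)]] algebra_simps)
qed

text \<open>
  The derivation with \<open>x \<mapsto> x y^i x\<close> that kills the other letters. On pairs
  \<open>(X, Y)\<close> of square matrices these induce the vector fields \<open>X \<mapsto> X Y^i X\<close>, quadratic in \<open>X\<close>.
\<close>

definition quad :: "'n \<Rightarrow> 'n \<Rightarrow> nat \<Rightarrow> ('n, 'k::field) talg \<Rightarrow> ('n, 'k) talg" where
  "quad x y i = der_of (\<lambda>l. if l = x then letter x * letter y ^ i * letter x else 0)"

lemma quad_Der: "quad x y i \<in> Der"
  unfolding quad_def by (rule der_of_Der)

lemma quad_letter: "quad x y i (letter l) = (if l = x then letter x * letter y ^ i * letter x else 0)"
  by (simp add: quad_def der_of_letter)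

lemma Der_power_zero: "f \<in> Der \<Longrightarrow> f b = 0 \<Longrightarrow> f (b ^ n) = 0"
  by (induction n) (simp_all add: Der_one Der_mult)

lemma quad_power:
  assumes "y \<noteq> x \<or> j = 0"
  shows "quad x y i (letter y ^ j) = 0"
  using assms by (auto simp: Der_power_zero[OF quad_Der] quad_letter Der_one[OF quad_Der])

text \<open>
  Both composites send \<open>x\<close> to \<open>x y^i x y^j x + x y^j x y^i x\<close>, as the powers of \<open>y\<close> are constants.
\<close>

lemma quad_commute:
  assumes "y \<noteq> x \<or> i = 0 \<and> j = 0"
  shows "bracket_der (quad x y i) (quad x y j) = (0 :: ('n, 'k::field) talg \<Rightarrow> _)"
proof
  fix a :: "('n, 'k) talg"
  have i: "quad x y j (letter y ^ i) = (0 :: ('n, 'k) talg)"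
    and j: "quad x y i (letter y ^ j) = (0 :: ('n, 'k) talg)"
    using assms by (auto intro!: quad_power)
  have "bracket_der (quad x y i) (quad x y j) (letter l :: ('n, 'k) talg) = 0" for l
    by (simp add: bracket_der_def quad_letter Der_mult[OF quad_Der] i j lin_zero[OF Der_lin[OF quad_Der]]
      distrib_left distrib_right mult.assoc)
  then show "bracket_der (quad x y i) (quad x y j) a = (0 :: ('n, 'k) talg \<Rightarrow> _) a"
    by (simp add: Der_eq_zero[OF bracket_Der[OF quad_Der quad_Der]])
qed

lemma gen_replicate: "gen (Word (replicate i y)) = (letter y ^ i :: ('n, 'k::field) talg)"
proof (induction i)
  case (Suc i)
  then show ?case by (simp add: gen_Cons[of y "replicate i y"])
qed (simp add: gen_Nil)

lemma quad_gen: "quad x y i (gen (Word w)) = ((\<Sum>v\<leftarrow>ins x y i w. gen (Word v)) :: ('n, 'k::field) talg)"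
proof (induction w)
  case Nil
  then show ?case by (simp add: gen_Nil Der_one[OF quad_Der])
next
  case (Cons l w)
  have "letter l * (\<Sum>v\<leftarrow>vs. gen (Word v)) = (\<Sum>v\<leftarrow>map ((#) l) vs. gen (Word v) :: ('n, 'k) talg)" for vs
  proof (induction vs)
    case (Cons v vs)
    then show ?case by (simp add: distrib_left gen_Cons[of l v])
  qed simp
  moreover have "letter x * letter y ^ i * letter x * gen (Word w) = (gen (Word (x # replicate i y @ x # w)) :: ('n, 'k) talg)"
    by (simp add: gen_Cons[of x "replicate i y @ x # w"] gen_Cons[of x w] gen_append gen_replicate mult.assoc)
  ultimately show ?case
    by (simp add: gen_Cons[of l w] Der_mult[OF quad_Der] quad_letter Cons.IH)
qed

section \<open>An invariant functional on the cyclic quotient\<close>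

lemma vs_field: "vector_space ((*) :: 'k::field \<Rightarrow> 'k \<Rightarrow> 'k)"
  by unfold_locales (simp_all add: algebra_simps)

text \<open>
  The identity on the left factor, tensored with the augmentation of the right factor: an algebra
  homomorphism from the enveloping algebra to the tensor algebra.
\<close>

definition right_unit :: "('n fmon, 'k::field) env \<Rightarrow> ('n, 'k) talg" where
  "right_unit = lext scal (\<lambda>z. if unop (snd z) = 0 then gen (fst z) else 0)"

lemma lin_right_unit: "lin scal scal right_unit"
  unfolding right_unit_def by (rule free.linear_lext)

lemma right_unit_tens: "right_unit (tens a b) = scal (Poly_Mapping.lookup b 0) a"
proof -
  have look: "lin scal scal (\<lambda>b :: ('a, 'b) talg. scal (Poly_Mapping.lookup b 0) a)" for a :: "('a, 'b) talg"
    by (simp add: Vector_Spaces.linear_iff free.vector_space_axioms lookup_add free.scale_left_distrib)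
  have scal: "lin scal scal (\<lambda>a :: ('a, 'b) talg. scal r a)" for r
    by (simp add: Vector_Spaces.linear_iff free.vector_space_axioms free.scale_right_distrib
      free.scale_left_commute)
  have *: "right_unit (tens a (gen v)) = scal (Poly_Mapping.lookup (gen v) 0) a"
    for a :: "('a, 'b) talg" and v
    by (rule free_ext[where s = scal and f = "\<lambda>a. right_unit (tens a (gen v))"
        and g = "\<lambda>a. scal (Poly_Mapping.lookup (gen v) 0) a", OF lin_comp[OF lin_tens_left lin_right_unit] scal])
      (simp add: tens_gen right_unit_def lookup_single)
  show ?thesis
    by (rule free_ext[where s = scal and f = "\<lambda>b. right_unit (tens a b)"
        and g = "\<lambda>b. scal (Poly_Mapping.lookup b 0) a", OF lin_comp[OF lin_tens_right lin_right_unit] look])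
      (rule *)
qed

lemma right_unit_mult: "right_unit (e * e') = right_unit e * right_unit e'"
proof -
  have *: "right_unit (gen z * gen z') = right_unit (gen z) * (right_unit (gen z') :: ('a, 'b) talg)" for z z'
  proof -
    obtain u v u' v' where z: "z = (u, Op (Word v))" "z' = (u', Op (Word v'))"
      by (metis fmon.exhaust opp.exhaust surj_pair)
    show ?thesis
      by (simp add: right_unit_def z gen_times plus_prod_def plus_opp_def plus_fmon_def zero_fmon_def)
  qed
  have *: "right_unit (gen z * e') = right_unit (gen z) * right_unit e'" for z
    by (rule free_ext[where s = scal and f = "\<lambda>e'. right_unit (gen z * e')"
        and g = "\<lambda>e'. right_unit (gen z) * right_unit e'"])
      (intro lin_comp[OF lin_mult_left lin_right_unit] lin_comp[OF lin_right_unit lin_mult_left] *)+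
  show ?thesis
    by (rule free_ext[where s = scal and f = "\<lambda>e. right_unit (e * e')"
        and g = "\<lambda>e. right_unit e * right_unit e'"])
      (intro lin_comp[OF lin_mult_right lin_right_unit] lin_comp[OF lin_right_unit lin_mult_right] *)+
qed

definition alt_form :: "nat \<Rightarrow> 'n \<Rightarrow> ('n, 'k::field_char_0) talg \<Rightarrow> 'k" where
  "alt_form k x = lext (*) (\<lambda>u. cyc_alt k x (letters u))"

lemma lin_alt_form: "lin scal (*) (alt_form k x)"
  unfolding alt_form_def by (rule vector_space.linear_lext[OF vs_field])

lemma alt_form_gen: "alt_form k x (gen (Word w)) = cyc_alt k x w"
  by (simp add: alt_form_def vector_space.lext_single[OF vs_field])

lemma alt_form_commute:
  fixes a b :: "('n, 'k::field_char_0) talg"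
  assumes "odd k"
  shows "alt_form k x (a * b) = alt_form k x (b * a)"
proof -
  note lin = lin_alt_form
  have *: "alt_form k x (gen (Word u) * gen (Word v)) = (alt_form k x (gen (Word v) * gen (Word u)) :: 'k)" for u v :: "'n list"
    unfolding gen_append[symmetric] alt_form_gen by (rule cyc_alt_commute[OF assms])
  have *: "alt_form k x (gen (Word u) * b) = (alt_form k x (b * gen (Word u)) :: 'k)" for u b
    by (rule talg_ext[where s = "(*)" and f = "\<lambda>b. alt_form k x (gen (Word u) * b)"
        and g = "\<lambda>b. alt_form k x (b * gen (Word u))"])
      (intro lin_comp[OF lin_mult_left lin] lin_comp[OF lin_mult_right lin] *)+
  show ?thesis
    by (rule talg_ext[where s = "(*)" and f = "\<lambda>a. alt_form k x (a * b)"
        and g = "\<lambda>a. alt_form k x (b * a)"])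
      (intro lin_comp[OF lin_mult_left lin] lin_comp[OF lin_mult_right lin] *)+
qed

lemma alt_form_quad:
  assumes "odd k" "y \<noteq> x \<or> i = 0"
  shows "alt_form k x (quad x y i a) = 0"
proof (rule talg_ext[where s = "(*)" and f = "\<lambda>a. alt_form k x (quad x y i a)" and g = "\<lambda>a. 0"])
  show "lin scal (*) (\<lambda>a. alt_form k x (quad x y i a))"
    by (rule lin_comp[OF Der_lin[OF quad_Der] lin_alt_form])
  show "lin scal (*) (\<lambda>a. 0)"
    by (intro lin_const_zero free.vector_space_axioms vs_field)
  show "alt_form k x (quad x y i (gen (Word w))) = 0" for w
    unfolding quad_gen lin_sum_list[OF lin_alt_form]
    using sum_cyc_alt_ins[OF assms] by (simp add: o_def alt_form_gen)
qed

text \<open>The derivations raise the degree, hence they map into the kernel of the augmentation.\<close>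

lemma lookup_quad_zero: "Poly_Mapping.lookup (quad x y i a) 0 = (0 :: 'k::field)"
proof (rule talg_ext[where s = "(*)" and f = "\<lambda>a. Poly_Mapping.lookup (quad x y i a) 0" and g = "\<lambda>a. 0"])
  have look: "lin scal (*) (\<lambda>b :: ('a, 'k) talg. Poly_Mapping.lookup b 0)"
    by (simp add: Vector_Spaces.linear_iff free.vector_space_axioms vs_field lookup_add)
  show "lin scal (*) (\<lambda>a :: ('a, 'k) talg. Poly_Mapping.lookup (quad x y i a) 0)"
    by (rule lin_comp[OF Der_lin[OF quad_Der] look])
  show "lin scal (*) (\<lambda>a :: ('a, 'k) talg. 0 :: 'k)"
    by (intro lin_const_zero free.vector_space_axioms vs_field)
  have nonempty: "[] \<notin> set (ins x y i w)" for w
    by (cases w) auto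
  have "[] \<notin> set vs \<Longrightarrow> (\<Sum>v\<leftarrow>vs. Poly_Mapping.lookup (gen (Word v)) 0) = (0 :: 'k)" for vs :: "'a list list"
    by (induction vs) (auto simp: lookup_single zero_fmon_def when_def)
  from this[OF nonempty] show "Poly_Mapping.lookup (quad x y i (gen (Word w))) 0 = (0 :: 'k)" for w
    unfolding quad_gen lin_sum_list[OF look] by (simp add: o_def)
qed

definition Alt :: "nat \<Rightarrow> 'n \<Rightarrow> ('n fmon, 'k::field_char_0) env \<Rightarrow> 'k" where
  "Alt k x e = alt_form k x (right_unit e)"

lemma lin_Alt: "lin scal (*) (Alt k x)"
  unfolding Alt_def[abs_def] by (rule lin_comp[OF lin_right_unit lin_alt_form])

lemma Alt_commute: "odd k \<Longrightarrow> Alt k x (e * e') = Alt k x (e' * e)"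
  by (simp add: Alt_def right_unit_mult alt_form_commute)

lemma Alt_phi_quad:
  assumes "odd k" "y \<noteq> x \<or> i = 0"
  shows "Alt k x (phi (quad x y i) e) = 0"
proof (rule env_ext[where s = "(*)" and f = "\<lambda>e. Alt k x (phi (quad x y i) e)" and g = "\<lambda>e. 0"])
  show "lin scal (*) (\<lambda>e. Alt k x (phi (quad x y i) e))"
    by (rule lin_comp[OF lin_phi[OF quad_Der] lin_Alt])
  show "lin scal (*) (\<lambda>e. 0)"
    by (intro lin_const_zero free.vector_space_axioms vs_field)
  show "Alt k x (phi (quad x y i) (tens a b)) = 0" for a b
    by (simp add: phi_tens[OF quad_Der] lin_add[OF lin_Alt])
      (simp add: Alt_def right_unit_tens lookup_quad_zero lin_scale[OF lin_alt_form] alt_form_quad[OF assms]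
        lin_zero[OF lin_alt_form])
qed

section \<open>Coboundaries at commuting derivations\<close>

lemma (in vector_space) cyc_lift:
  fixes L :: "('m::monoid_add \<Rightarrow>\<^sub>0 'a) \<Rightarrow> 'b"
  assumes "lin scal scale L" "\<And>a b. L (a * b) = L (b * a)"
  obtains g where "lin scale_cyc scale g" "\<And>b. g (cyc b) = L b"
proof -
  have L: "lext scale (\<lambda>u. L (gen u)) b = L b" for b
    by (rule free_ext[OF linear_lext assms(1)]) simp
  have zero: "lext scale (\<lambda>u. L (gen u)) x = 0" if "x \<in> {a * b - b * a | a b. True}" for x
    using that by (auto simp: L lin_diff[OF assms(1)] assms(2)[of _ _])
  note lift = quotient_lift[OF Quotient3_cyc _ plus_cyc.abs_eq scale_cyc.abs_eq cyc.vector_space_axioms]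
  show ?thesis
  proof (rule that)
    show "lin scale_cyc scale (\<lambda>t. lext scale (\<lambda>u. L (gen u)) (rep_cyc t))"
      by (rule lift(1)) (rule zero)
    show "lext scale (\<lambda>u. L (gen u)) (rep_cyc (cyc b)) = L b" for b
      by (subst lift(2)) (rule zero, assumption, rule L)
  qed
qed

text \<open>
  The action is well defined because \<open>phi f\<close> is a derivation, so that it maps commutators to sums of
  commutators.
\<close>

lemma act_der_cyc:
  assumes "f \<in> Der"
  shows "act_der f (cyc b) = cyc (phi f b)"
proof -
  have "cyc (phi f (a * b)) = cyc (phi f (b * a))" for a b
    by (simp add: Der_mult[OF phi_Der[OF assms]] cyc_commute add.commute flip: plus_cyc.abs_eq)
  then obtain g where g: "\<And>b. g (cyc b) = cyc (phi f b)"
    using cyc.cyc_lift[OF lin_comp[OF lin_phi[OF assms] lin_cyc]] by blast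
  show ?thesis
    unfolding act_der_def by (rule the_equality) (metis g)+
qed

text \<open>
  On commuting elements the bracket terms of a coboundary vanish, so a functional that kills the
  action of these elements kills the coboundary.
\<close>

lemma coboundary_vanishes:
  fixes \<beta> :: "(('m::monoid_add \<Rightarrow>\<^sub>0 'k::field) \<Rightarrow> ('m \<Rightarrow>\<^sub>0 'k)) list \<Rightarrow> ('m \<times> 'm opp, 'k) cyc"
  assumes \<beta>: "\<beta> \<in> CE_coboundaries Der scale_der scale_cyc bracket_der act_der k"
    and L: "lin scale_cyc (*) L" "\<And>f t. f \<in> set fs \<Longrightarrow> L (act_der f t) = 0"
    and comm: "\<And>f g. f \<in> set fs \<Longrightarrow> g \<in> set fs \<Longrightarrow> bracket_der f g = 0"
  shows "L (\<beta> fs) = 0"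
proof (cases k)
  case 0
  then show ?thesis using \<beta> by (simp add: lin_zero[OF L(1)])
next
  case (Suc k')
  then obtain \<gamma> where \<gamma>: "\<gamma> \<in> CE_cochains Der scale_der scale_cyc k'"
    and \<beta>: "\<beta> = CE_diff Der scale_cyc bracket_der act_der k' \<gamma>"
    using \<beta> by auto
  have zero: "\<gamma> (0 # zs) = 0" for zs
  proof (cases "0 # zs \<in> tuples Der k'")
    case True
    then have "0 < k'" by (auto simp: tuples_def)
    then have "\<gamma> ((0 # zs)[0 := scale_der 0 0]) = scale_cyc 0 (\<gamma> ((0 # zs)[0 := 0]))"
      using \<gamma> True unfolding CE_cochains_def tuples_def by (blast intro: list.set_intros)
    moreover have "scale_der 0 0 = (0 :: ('m \<Rightarrow>\<^sub>0 'k) \<Rightarrow> _)"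
      by (rule ext) (simp add: scale_der_def)
    ultimately show ?thesis by simp
  qed (use \<gamma> in \<open>simp add: CE_cochains_def\<close>)
  show ?thesis
  proof (cases "fs \<in> tuples Der (Suc k')")
    case True
    then have len: "length fs = Suc k'" by (simp add: tuples_def)
    have 1: "L (scale_cyc ((-1) ^ i) (act_der (fs ! i) t)) = 0" if "i \<le> k'" for i t
      using that len by (simp add: lin_scale[OF L(1)] L(2))
    have 2: "\<gamma> (bracket_der (fs ! i) (fs ! j) # zs) = 0" if "j \<le> k'" "i < j" for i j zs
      using that len by (simp add: comm zero)
    show ?thesis
      unfolding \<beta> CE_diff_def using True 1 2
      by (simp add: lin_add[OF L(1)] lin_sum[OF L(1)] lin_zero[OF L(1)])
  qed (simp add: \<beta> CE_diff_def lin_zero[OF L(1)])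
qed

section \<open>The value of the trace class\<close>

text \<open>
  The \<open>(x, x)\<close> entry of minus the Jacobian matrix of \<open>quad x y i\<close>: the two summands come from the
  two outer letters of \<open>x y^i x\<close>. All rows other than that of \<open>x\<close> vanish.
\<close>

definition jac :: "'n \<Rightarrow> 'n \<Rightarrow> nat \<Rightarrow> ('n fmon, 'k::field) env" where
  "jac x y i = - (tens 1 (letter y ^ i * letter x) + tens (letter x * letter y ^ i) 1)"

lemma fox_power:
  assumes "y \<noteq> x \<or> i = 0"
  shows "fox x (letter y ^ i) = 0"
proof -
  have "fox x (letter y) = 0" if "y \<noteq> x" using that by simp
  moreover have "fox x 1 = 0" using fox_gen[of x "[]"] by (simp add: gen_Nil)
  ultimately show ?thesis using assms by (induction i) (auto simp: fox_mult)
qed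

lemma coord_c_nabla_quad:
  fixes m :: "('n::finite fmon, 'k::field) omega"
  assumes "y \<noteq> x \<or> i = 0"
  shows "coord x (c_nabla (quad x y i) m) = coord x m * jac x y i"
    and "coord x m = 0 \<Longrightarrow> c_nabla (quad x y i) m = 0"
proof -
  note c = lin_c_nabla[OF quad_Der] c_nabla_env_act[OF quad_Der] c_nabla_letter[OF quad_Der]
  have other: "c_nabla (quad x y i) (d (letter j)) = (0 :: ('n fmon, 'k) omega)" if "j \<noteq> x" for j
    using that by (simp add: c(3) quad_letter lin_zero[OF lin_d])
  have "c_nabla (quad x y i) m = (\<Sum>j\<in>UNIV. env_act (coord j m) (c_nabla (quad x y i) (d (letter j))))"
    by (subst omega_expand[of m]) (simp add: lin_sum[OF c(1)] c(2))
  also have "\<dots> = (\<Sum>j\<in>UNIV. if j = x then env_act (coord x m) (c_nabla (quad x y i) (d (letter x))) else 0)"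
    by (intro sum.cong) (auto simp: other lin_zero[OF lin_env_act_right])
  finally have *: "c_nabla (quad x y i) m = env_act (coord x m) (c_nabla (quad x y i) (d (letter x)))"
    by simp
  have "coord x (- m') = - coord x m'" for m' :: "('n fmon, 'k) omega"
    using lin_diff[OF lin_coord, of x 0 m'] by (simp add: lin_zero[OF lin_coord])
  then have "coord x (c_nabla (quad x y i) (d (letter x))) = (jac x y i :: ('n fmon, 'k) env)"
    by (simp add: c(3) quad_letter coord_d fox_mult fox_power[OF assms] jac_def gen_Nil tens_mult add.commute
      flip: one_env)
  then show "coord x (c_nabla (quad x y i) m) = coord x m * jac x y i"
    unfolding * coord_env_act by simp
  show "coord x m = 0 \<Longrightarrow> c_nabla (quad x y i) m = 0"
    unfolding * by (simp add: lin_zero[OF lin_env_act_left])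
qed

text \<open>
  As only the row of \<open>x\<close> is nonzero, the diagonal entry at \<open>x\<close> of a product of Jacobians is the
  product of the entries at \<open>x\<close>, and the other diagonal entries are 0.
\<close>

lemma Tr_quad:
  fixes x y :: "'n::finite"
  assumes "\<forall>i\<in>set N. y \<noteq> x \<or> i = 0" "N \<noteq> []"
  shows "Tr (foldr (\<lambda>i g. c_nabla (quad x y i) \<circ> g) N id)
    = (cyc (prod_list (rev (map (jac x y) N))) :: ('n fmon \<times> 'n fmon opp, 'k::field) cyc)"
proof -
  let ?\<Phi> = "\<lambda>N. foldr (\<lambda>i g. c_nabla (quad x y i) \<circ> g) N (id :: ('n fmon, 'k) omega \<Rightarrow> _)"
  have lin: "lin scale_omega scale_omega (?\<Phi> N)" for N
  proof (induction N)
    case Nil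
    show ?case by (simp add: Vector_Spaces.linear_iff omega.vector_space_axioms)
  next
    case (Cons i N)
    show ?case using lin_comp[OF Cons.IH lin_c_nabla[OF quad_Der]] by (simp add: o_def)
  qed
  have act: "?\<Phi> N (env_act e m) = env_act e (?\<Phi> N m)" for N e m
    by (induction N) (simp_all add: c_nabla_env_act[OF quad_Der])
  have coord: "coord x (?\<Phi> N m) = coord x m * prod_list (rev (map (jac x y) N))"
    if "\<forall>i\<in>set N. y \<noteq> x \<or> i = 0" for N m
    using that by (induction N) (simp_all add: coord_c_nabla_quad(1) mult.assoc)
  obtain i N' where N: "N = i # N'" using assms(2) by (cases N) auto
  have other: "?\<Phi> N (d (letter j)) = 0" if "j \<noteq> x" for j
    using that assms(1) by (simp add: N coord_c_nabla_quad(2) coord coord_letter)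
  have "Tr (?\<Phi> N) = (\<Sum>j\<in>UNIV. if j = x then cyc (coord x (?\<Phi> N (d (letter x)))) else 0)"
    unfolding Tr_coord[OF lin act]
    by (intro sum.cong) (auto simp: other lin_zero[OF lin_coord] lin_zero[OF lin_cyc])
  also have "\<dots> = cyc (prod_list (rev (map (jac x y) N)))"
    by (simp add: coord[OF assms(1)] coord_letter)
  finally show ?thesis .
qed

text \<open>The augmentation of the right factor kills the first summand \<open>1 \<otimes> y^i x\<close> of \<open>jac\<close>.\<close>

lemma right_unit_jac: "right_unit (jac x y i) = - gen (Word (x # replicate i y))"
proof -
  have "letter y ^ i * letter x = (gen (Word (replicate i y @ [x])) :: ('a, 'b::field) talg)"
    by (simp add: gen_append gen_replicate)
  then have 0: "Poly_Mapping.lookup (letter y ^ i * letter x) 0 = (0 :: 'b)"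
    by (simp add: lookup_single zero_fmon_def)
  have "right_unit (- e) = - right_unit e" for e :: "('a fmon, 'b) env"
    using lin_diff[OF lin_right_unit, of 0 e] by (simp add: lin_zero[OF lin_right_unit])
  then show ?thesis
    by (simp add: jac_def lin_add[OF lin_right_unit] lin_diff[OF lin_right_unit] right_unit_tens 0 gen_Cons[of x "replicate i y"]
      gen_replicate lookup_one)
qed

lemma right_unit_prod_jac:
  "right_unit (prod_list (map (jac x y) N))
    = scal ((-1) ^ length N) (gen (Word (concat (map (\<lambda>i. x # replicate i y) N))))"
proof (induction N)
  case Nil
  have "right_unit 1 = 1" by (simp add: one_env right_unit_tens)
  then show ?case by (simp add: gen_Nil)
next
  case (Cons i N)
  have "- p = scal (-1) p" for p :: "('a, 'b) talg" by simp
  with Cons show ?case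
    by (simp add: right_unit_mult right_unit_jac scal_mult_right
      gen_append[of "x # replicate i y" "concat (map (\<lambda>i. x # replicate i y) N)", simplified])
qed

lemma Alt_prod_jac:
  assumes "\<forall>i\<in>set N. y \<noteq> x \<or> i = 0"
  shows "Alt k x (prod_list (map (jac x y) N)) = (-1) ^ length N * alt k N"
proof -
  have "close (0, N) = N" by (cases N rule: rev_cases) auto
  then show ?thesis
    by (simp add: Alt_def right_unit_prod_jac lin_scale[OF lin_alt_form] alt_form_gen cyc_alt_def
      exps_concat[OF assms] del: close.simps)
qed

theorem theorem4p15:
  fixes k :: nat
  assumes "odd k" and "CARD('n::finite) \<ge> 2 \<or> k = 1"
  shows "class_Der k
      (Tr_c_power k :: (('n, 'k::field_char_0) talg \<Rightarrow> ('n, 'k) talg) list \<Rightarrow> ('n fmon \<times> 'n fmon opp, 'k) cyc)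
    \<noteq> class_Der k 0"
proof
  let ?\<eta> = "Tr_c_power k :: (('n, 'k) talg \<Rightarrow> ('n, 'k) talg) list \<Rightarrow> ('n fmon \<times> 'n fmon opp, 'k) cyc"
  let ?B = "CE_coboundaries Der scale_der scale_cyc bracket_der act_der k
    :: ((('n, 'k) talg \<Rightarrow> ('n, 'k) talg) list \<Rightarrow> ('n fmon \<times> 'n fmon opp, 'k) cyc) set"
  assume eq: "class_Der k ?\<eta> = class_Der k 0"
  obtain k' where k': "k = Suc k'" using assms(1) by (cases k) auto
  \<comment> \<open>For \<open>k = 1\<close> only \<open>x \<mapsto> x x\<close> occurs, and one letter is enough.\<close>
  obtain x y :: 'n where xy: "y \<noteq> x \<or> k = 1"
  proof (cases "k = 1")
    case False
    then have "\<not> CARD('n) \<le> 1" using assms(2) by auto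
    then obtain x y :: 'n where "y \<noteq> x" by (metis card_le_Suc0_iff_eq[OF finite] One_nat_def UNIV_I)
    then show ?thesis using that by blast
  qed (use that in blast)
  then have gap: "y \<noteq> x \<or> i = 0" if "i < k" for i using that by auto
  define fs where "fs = map (quad x y :: nat \<Rightarrow> ('n, 'k) talg \<Rightarrow> ('n, 'k) talg) [0..<k]"
  have fs: "fs \<in> tuples Der k" by (auto simp: fs_def tuples_def quad_Der)
  obtain L :: "('n fmon \<times> 'n fmon opp, 'k) cyc \<Rightarrow> 'k"
    where L: "lin scale_cyc (*) L" "\<And>e. L (cyc e) = Alt k x e"
    by (rule vector_space.cyc_lift[OF vs_field lin_Alt Alt_commute[OF assms(1)]]) (rule that)
  have L_act: "L (act_der f t) = 0" if "f \<in> set fs" for f t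
  proof -
    obtain e where "t = cyc e" by (metis Quotient3_abs_rep[OF Quotient3_cyc])
    then show ?thesis
      using that by (auto simp: fs_def act_der_cyc[OF quad_Der] L(2) Alt_phi_quad[OF assms(1) gap])
  qed
  have "bracket_der f g = 0" if "f \<in> set fs" "g \<in> set fs" for f g
    using that gap by (auto simp: fs_def intro!: quad_commute)
  then have L_B: "L (\<beta> fs) = 0" if "\<beta> \<in> ?B" for \<beta>
    using coboundary_vanishes[OF that L(1) L_act] by blast
  \<comment> \<open>Equal cosets only give \<open>\<eta>\<close> as a difference of two coboundaries, which is just as good.\<close>
  have "0 \<in> CE_cochains Der scale_der scale_cyc k'" by (simp add: CE_cochains_def)
  then obtain \<beta> where \<beta>: "\<beta> \<in> ?B" unfolding k' by auto
  then have "?\<eta> + \<beta> \<in> class_Der k ?\<eta>" unfolding CE_class_def by blast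
  then have "?\<eta> + \<beta> \<in> class_Der k 0" by (simp only: eq)
  then obtain \<beta>' where \<beta>': "\<beta>' \<in> ?B" "?\<eta> + \<beta> = \<beta>'" unfolding CE_class_def by auto
  have "L (?\<eta> fs) = 0"
    using L_B[OF \<beta>] L_B[OF \<beta>'(1)] lin_add[OF L(1), of "?\<eta> fs" "\<beta> fs"] \<beta>'(2) by auto
  \<comment> \<open>The signs of the antisymmetrisation and of the functional cancel, so all \<open>k!\<close> summands agree.\<close>
  moreover have "L (?\<eta> fs) = - of_nat (fact k)"
  proof -
    have "L (Tr (foldr (\<lambda>i g. c_nabla (fs ! s i) \<circ> g) [0..<k] id)) = - alt k (rev (map s [0..<k]))"
      if s: "s permutes {..<k}" for s
    proof -
      have s_less: "s i < k" if "i < k" for i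
        using permutes_in_image[OF s, of i] that by simp
      define N where "N = map s [0..<k]"
      have N: "\<forall>i\<in>set N. y \<noteq> x \<or> i = 0" "N \<noteq> []" "length N = k"
        using gap s_less by (auto simp: N_def k')
      have "foldr (\<lambda>i g. c_nabla (fs ! s i) \<circ> g) [0..<k] id = foldr (\<lambda>i g. c_nabla (quad x y i) \<circ> g) N id"
        unfolding N_def foldr_map by (rule foldr_cong) (auto simp: fs_def s_less o_def)
      then have "L (Tr (foldr (\<lambda>i g. c_nabla (fs ! s i) \<circ> g) [0..<k] id))
        = Alt k x (prod_list (map (jac x y) (rev N)))"
        by (simp only: Tr_quad[OF N(1,2)] L(2) rev_map)
      also have "\<dots> = (-1) ^ length (rev N) * alt k (rev N)"
        using N(1) by (intro Alt_prod_jac) simp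
      finally show ?thesis
        using assms(1) N(3) by (simp add: N_def)
    qed
    then have "L (?\<eta> fs) = (\<Sum>s | s permutes {..<k}. - (of_int (sign s) * alt k (rev (map s [0..<k]))))"
      using fs by (simp add: Tr_c_power_def lin_sum[OF L(1)] lin_scale[OF L(1)])
    then show ?thesis by (simp add: sum_negf sum_alt)
  qed
  ultimately show False by simp
qed

end
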